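(* Assume the setting described in the context, assume for all $x\in[a,b]^{\ell_0}$ that $f(x)=f(0)$, and let $\Theta\in C([0,\infty),\mathbb R^{\mathfrak d})$ satisfy for all $t\in[0,\infty)$ that $\Theta_t=\Theta_0-\int_0^t\mathcal G(\Theta_s)\,ds$. Then (i) $\sup_{t\in[0,\infty)}\|\Theta_t\|\le[2V(\Theta_0)+4L^2\|f(0)\|^2]^{1/2}<\infty$, (ii) for all $t\in(0,\infty)$ it holds that $\mathcal L_\infty(\Theta_t)\le\frac1{2t}[\|\Theta_0\|^2+2L\|f(0)\|^2]<\infty$, and (iii) $\limsup_{t\to\infty}\mathcal L_\infty(\Theta_t)=0$.
   Context: Setting. Let $L,\mathfrak d\in\mathbb N=\{1,2,\dots\}$, $(\ell_k)_{k\in\mathbb N_0}\subseteq\mathbb N$, $a\in\mathbb R$, $b\in(a,\infty)$, $\mathscr A\in(0,\infty)$, $\mathscr B\in(\mathscr A,\infty)$ with $\mathfrak d=\sum_{k=1}^L\ell_k(\ell_{k-1}+1)$; let $\mathbf d_k=\sum_{h=1}^k\ell_h(\ell_{h-1}+1)$ for $k\in\mathbb N_0$. For $\theta=(\theta_1,\dots,\theta_{\mathfrak d})\in\mathbb R^{\mathfrak d}$, $k\in\{1,\dots,L\}$, $i\in\{1,\dots,\ell_k\}$, $j\in\{1,\dots,\ell_{k-1}\}$ let $\mathfrak w^{k,\theta}_{i,j}=\theta_{(i-1)\ell_{k-1}+j+\mathbf d_{k-1}}$ and $\mathfrak b^{k,\theta}_i=\theta_{\ell_k\ell_{k-1}+i+\mathbf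 d_{k-1}}$, let $\mathfrak w^{k,\theta}=(\mathfrak w^{k,\theta}_{i,j})_{i,j}\in\mathbb R^{\ell_k\times\ell_{k-1}}$, $\mathfrak b^{k,\theta}=(\mathfrak b^{k,\theta}_1,\dots,\mathfrak b^{k,\theta}_{\ell_k})\in\mathbb R^{\ell_k}$, and $\mathcal A^\theta_k\colon\mathbb R^{\ell_{k-1}}\to\mathbb R^{\ell_k}$, $\mathcal A^\theta_k(x)=\mathfrak b^{k,\theta}+\mathfrak w^{k,\theta}x$. Let $\mathscr R_\infty(x)=\max\{x,0\}$ and let $\mathscr R_r\colon\mathbb R\to\mathbb R$, $r\in[1,\infty)$, satisfy for all $r\in[1,\infty)$: $\mathscr R_r\in C^1(\mathbb R,\mathbb R)$, $\mathscr R_r(x)=0$ for all $x\le\mathscr A r^{-1}$, $0\le\mathscr R_r(y)\le\max\{y,0\}$ for all $y\in\mathbb R$, $\mathscr R_r(z)=z$ for all $z\ge\mathscr B r^{-1}$; assume $\sup_{r\in[1,\infty)}\sup_{x\in\mathbb R}|(\mathscr R_r)'(x)|<\infty$. $\|\cdot\|$, $\langle\cdot,\cdot\rangle$ are the Euclidean norm and scalar product on each $\mathbb R^n$; for $r\in[1,\infty]$, $\mathfrak M_r(x_1,\dots,x_n)=(\mathscr R_r(x_1),\dots,\mathscr R_r(x_n))$. For $r\in[1,\infty]$, $\theta\in\mathbb R^{\mathfrak d}$ define $\mathcal N^{k,\theta}_r\colon\mathbb R^{\ell_0}\to\mathbb R^{\ell_k}$, $k\in\{1,\dots,L\}$, by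 $\mathcal N^{1,\theta}_r=\mathcal A^\theta_1$ and $\mathcal N^{k+1,\theta}_r(x)=\mathcal A^\theta_{k+1}(\mathfrak M_{r^{1/k}}(\mathcal N^{k,\theta}_r(x)))$ (with $\infty^{1/k}=\infty$). Let $\mu$ be a measure on the Borel $\sigma$-algebra of $[a,b]^{\ell_0}$ with $\mu([a,b]^{\ell_0})\in\mathbb R$, let $f=(f_1,\dots,f_{\ell_L})\colon\mathbb R^{\ell_0}\to\mathbb R^{\ell_L}$ be measurable (only its values on $[a,b]^{\ell_0}$ and the value $f(0)$ enter), and for $r\in[1,\infty]$ let $\mathcal L_r\colon\mathbb R^{\mathfrak d}\to\mathbb R$ be given by $\mathcal L_r(\theta)=\int_{[a,b]^{\ell_0}}\|\mathcal N^{L,\theta}_r(x)-f(x)\|^2\,\mu(dx)$ (these integrals are real numbers as part of the setting). Let $\mathcal G\colon\mathbb R^{\mathfrak d}\to\mathbb R^{\mathfrak d}$ satisfy $\mathcal G(\theta)=\lim_{r\to\infty}(\nabla\mathcal L_r)(\theta)$ for every $\theta$ for which $((\nabla\mathcal L_r)(\theta))_{r\in[1,\infty)}$ is convergent as $r\to\infty$. Let $V\colon\mathbb R^{\mathfrak d}\to\mathbb R$, $V(\theta)=\big[\sum_{k=1}^L\big(k\|\mathfrak b^{k,\theta}\|^2+\sum_{i=1}^{\ell_k}\sum_{j=1}^{\ell_{k-1}}|\mathfrak w^{k,\theta}_{i,j}|^2\big)\big]-2L\langle f(0),\mathfrak b^{L,\theta}\rangle$. *)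

theory Defs
  imports "HOL-Analysis.Analysis"
begin

text \<open>Vectors of R^n are represented as functions nat => real, of which only the
  components with index in {1..n} are relevant.\<close>

definition vnorm :: "nat \<Rightarrow> (nat \<Rightarrow> real) \<Rightarrow> real" where
  "vnorm n x = sqrt (\<Sum>i=1..n. (x i)\<^sup>2)"

definition vinner :: "nat \<Rightarrow> (nat \<Rightarrow> real) \<Rightarrow> (nat \<Rightarrow> real) \<Rightarrow> real" where
  "vinner n x y = (\<Sum>i=1..n. x i * y i)"

definition dsum :: "(nat \<Rightarrow> nat) \<Rightarrow> nat \<Rightarrow> nat" where
  "dsum l k = (\<Sum>h=1..k. l h * (l (h - 1) + 1))"

definition wgt :: "(nat \<Rightarrow> nat) \<Rightarrow> nat \<Rightarrow> (nat \<Rightarrow> real) \<Rightarrow> nat \<Rightarrow> nat \<Rightarrow> real" where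
  "wgt l k \<theta> i j = \<theta> ((i - 1) * l (k - 1) + j + dsum l (k - 1))"

definition bias :: "(nat \<Rightarrow> nat) \<Rightarrow> nat \<Rightarrow> (nat \<Rightarrow> real) \<Rightarrow> nat \<Rightarrow> real" where
  "bias l k \<theta> i = \<theta> (l k * l (k - 1) + i + dsum l (k - 1))"

definition affine_layer :: "(nat \<Rightarrow> nat) \<Rightarrow> nat \<Rightarrow> (nat \<Rightarrow> real) \<Rightarrow> (nat \<Rightarrow> real) \<Rightarrow> (nat \<Rightarrow> real)" where
  "affine_layer l k \<theta> x =
     (\<lambda>i. if i \<in> {1..l k} then bias l k \<theta> i + (\<Sum>j=1..l (k - 1). wgt l k \<theta> i j * x j) else 0)"

text \<open>Realization with activation act k applied (componentwise) after layer k: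
  N^1 = A_1, N^{k+1} = A_{k+1} o M_{act k} o N^k.  (Index 0 is unused.)\<close>
fun realization :: "(nat \<Rightarrow> nat) \<Rightarrow> (nat \<Rightarrow> real \<Rightarrow> real) \<Rightarrow> (nat \<Rightarrow> real) \<Rightarrow> nat
                     \<Rightarrow> (nat \<Rightarrow> real) \<Rightarrow> (nat \<Rightarrow> real)" where
  "realization l act \<theta> 0 x = x"
| "realization l act \<theta> (Suc 0) x = affine_layer l 1 \<theta> x"
| "realization l act \<theta> (Suc (Suc k)) x =
     affine_layer l (Suc (Suc k)) \<theta> (\<lambda>i. act (Suc k) (realization l act \<theta> (Suc k) x i))"

definition NN_r :: "(nat \<Rightarrow> nat) \<Rightarrow> (real \<Rightarrow> real \<Rightarrow> real) \<Rightarrow> real \<Rightarrow> (nat \<Rightarrow> real) \<Rightarrow> nat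
                     \<Rightarrow> (nat \<Rightarrow> real) \<Rightarrow> (nat \<Rightarrow> real)" where
  "NN_r l R r \<theta> = realization l (\<lambda>k. R (r powr (1 / real k))) \<theta>"

definition NN_inf :: "(nat \<Rightarrow> nat) \<Rightarrow> (nat \<Rightarrow> real) \<Rightarrow> nat \<Rightarrow> (nat \<Rightarrow> real) \<Rightarrow> (nat \<Rightarrow> real)" where
  "NN_inf l \<theta> = realization l (\<lambda>k y. max y 0) \<theta>"

definition sq_err :: "(nat \<Rightarrow> nat) \<Rightarrow> nat \<Rightarrow> ((nat \<Rightarrow> real) \<Rightarrow> (nat \<Rightarrow> real))
                        \<Rightarrow> ((nat \<Rightarrow> real) \<Rightarrow> (nat \<Rightarrow> real)) \<Rightarrow> (nat \<Rightarrow> real) \<Rightarrow> real" where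
  "sq_err l L N f x = (vnorm (l L) (\<lambda>i. N x i - f x i))\<^sup>2"

definition loss_r :: "(nat \<Rightarrow> nat) \<Rightarrow> nat \<Rightarrow> (real \<Rightarrow> real \<Rightarrow> real) \<Rightarrow> (nat \<Rightarrow> real) measure
                       \<Rightarrow> ((nat \<Rightarrow> real) \<Rightarrow> (nat \<Rightarrow> real)) \<Rightarrow> real \<Rightarrow> (nat \<Rightarrow> real) \<Rightarrow> real" where
  "loss_r l L R \<mu> f r \<theta> = (\<integral>x. sq_err l L (NN_r l R r \<theta> L) f x \<partial>\<mu>)"

definition loss_inf :: "(nat \<Rightarrow> nat) \<Rightarrow> nat \<Rightarrow> (nat \<Rightarrow> real) measure
                       \<Rightarrow> ((nat \<Rightarrow> real) \<Rightarrow> (nat \<Rightarrow> real)) \<Rightarrow> (nat \<Rightarrow> real) \<Rightarrow> real" where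
  "loss_inf l L \<mu> f \<theta> = (\<integral>x. sq_err l L (NN_inf l \<theta> L) f x \<partial>\<mu>)"

definition grad :: "((nat \<Rightarrow> real) \<Rightarrow> real) \<Rightarrow> (nat \<Rightarrow> real) \<Rightarrow> nat \<Rightarrow> real" where
  "grad F \<theta> i = deriv (\<lambda>h. F (\<theta>(i := \<theta> i + h))) 0"

definition cube :: "nat \<Rightarrow> real \<Rightarrow> real \<Rightarrow> (nat \<Rightarrow> real) set" where
  "cube n a b = {x. (\<forall>i\<in>{1..n}. x i \<in> {a..b}) \<and> (\<forall>i. i \<notin> {1..n} \<longrightarrow> x i = 0)}"

definition Vfun :: "(nat \<Rightarrow> nat) \<Rightarrow> nat \<Rightarrow> ((nat \<Rightarrow> real) \<Rightarrow> (nat \<Rightarrow> real)) \<Rightarrow> (nat \<Rightarrow> real) \<Rightarrow> real" where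
  "Vfun l L f \<theta> =
     (\<Sum>k=1..L. real k * (vnorm (l k) (bias l k \<theta>))\<^sup>2
                + (\<Sum>i=1..l k. \<Sum>j=1..l (k - 1). (wgt l k \<theta> i j)\<^sup>2))
     - 2 * real L * vinner (l L) (f (\<lambda>_. 0)) (bias l L \<theta>)"

end

theory Submission
  imports Defs
begin

text \<open>Write \<open>D\<^sub>\<theta> N[\<eta>]\<close> for the derivative of the realization in a parameter direction \<open>\<eta>\<close>,
  with the indicator of the positive half-line as derivative of the ReLU function. Layer by layer
  the regularized networks converge so fast that their derivatives converge pointwise to
  \<open>D\<^sub>\<theta> N\<close>, even where the input of a ReLU unit vanishes. Dominated convergence
  identifies \<open>G\<close> with the resulting generalized gradient and, applied to the
  chain rule for the regularized losses along the flow, shows that the ReLU loss is nonincreasing.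
  By homogeneity, \<open>D\<^sub>\<theta> N[\<nabla>V(\<theta>)] = 2 L (N - f(0))\<close>, so that the derivative of \<open>V\<close> along the
  flow is \<open>-4 L\<close> times the loss. Hence \<open>V\<close> decreases along the flow, and since the loss is
  nonincreasing, \<open>4 L t\<close> times the loss at time \<open>t\<close> is at most \<open>V(\<Theta>\<^sub>0) - V(\<Theta>\<^sub>t)\<close>.\<close>

section \<open>Parameter vectors\<close>

text \<open>The ReLU loss need not be differentiable and its generalized gradient may jump, so the
  flow is only a primitive of a locally bounded velocity and no classical chain rule is at hand. The
  regularized losses and \<open>V\<close> have continuous partial derivatives; for them a chain rule
  survives that asks of the velocity only boundedness and integrability. The limit in the
  regularization is taken in the integrated identity, where the product of the two gradients turns
  into a squared norm. The exponents 1/k serve the units with limiting input 0. Such a unit of layer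
  k receives an input of size o(r^(-1/k)), eventually below A r^(-1/k), where the regularized
  activation vanishes identically. Its derivative is then exactly 0. Pointwise convergence of the
  networks alone would not decide this case. The factor k at the biases of layer k in
  \<open>V\<close> reflects that the output of layer k has degree k under the scaling behind Euler's
  identity; the linear term of \<open>V\<close> replaces N by N - f(0) there. The explicit constants
  of the theorem come from completing squares, with the quadratic coefficients of \<open>V\<close>
  lying between 1 and L.\<close>

definition widx :: "(nat \<Rightarrow> nat) \<Rightarrow> nat \<Rightarrow> nat \<Rightarrow> nat \<Rightarrow> nat" where
  "widx l k i j = (i - 1) * l k + j + dsum l k"

definition bidx :: "(nat \<Rightarrow> nat) \<Rightarrow> nat \<Rightarrow> nat \<Rightarrow> nat" where
  "bidx l k i = l (Suc k) * l k + i + dsum l k"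

text \<open>Numbering the layers from 0 removes the truncated \<open>k - 1\<close> and matches the
  \<open>Suc\<close> steps of the recursion for realizations.\<close>

lemma wgt_Suc: "wgt l (Suc k) \<theta> i j = \<theta> (widx l k i j)"
  by (simp add: wgt_def widx_def)

lemma bias_Suc: "bias l (Suc k) \<theta> i = \<theta> (bidx l k i)"
  by (simp add: bias_def bidx_def)

lemma dsum_0 [simp]: "dsum l 0 = 0"
  by (simp add: dsum_def)

lemma dsum_Suc: "dsum l (Suc k) = dsum l k + l (Suc k) * l k + l (Suc k)"
  by (simp add: dsum_def)

lemma dsum_mono: "k \<le> m \<Longrightarrow> dsum l k \<le> dsum l m"
  unfolding dsum_def by (rule sum_mono2) auto

lemma grid_index_le:
  fixes i j p q :: nat
  assumes "i \<in> {1..p}" "j \<in> {1..q}"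
  shows "(i - 1) * q + j \<le> p * q"
proof -
  have "(i - 1) * q + j \<le> (i - 1) * q + q" using assms by simp
  also have "\<dots> = i * q" using assms by (cases i) auto
  also have "\<dots> \<le> p * q" using assms by simp
  finally show ?thesis .
qed

lemma widx_mem:
  assumes "k < n" "i \<in> {1..l (Suc k)}" "j \<in> {1..l k}"
  shows "widx l k i j \<in> {1..dsum l n}"
proof -
  have "widx l k i j \<le> dsum l (Suc k)"
    using grid_index_le[OF assms(2,3)] by (simp add: widx_def dsum_Suc)
  also have "\<dots> \<le> dsum l n" using assms(1) by (intro dsum_mono) simp
  finally show ?thesis using assms(3) by (simp add: widx_def)
qed

lemma bidx_mem:
  assumes "k < n" "i \<in> {1..l (Suc k)}"
  shows "bidx l k i \<in> {1..dsum l n}"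
proof -
  have "bidx l k i \<le> dsum l (Suc k)"
    using assms(2) by (simp add: bidx_def dsum_Suc)
  also have "\<dots> \<le> dsum l n" using assms(1) by (intro dsum_mono) simp
  finally show ?thesis using assms(2) by (simp add: bidx_def)
qed

lemma sum_shift_block:
  fixes g :: "nat \<Rightarrow> real"
  shows "(\<Sum>m=1..p + q. g m) = (\<Sum>m=1..p. g m) + (\<Sum>i=1..q. g (i + p))"
  by (induction q) (auto simp: add.commute add.left_commute)

lemma sum_grid:
  fixes g :: "nat \<Rightarrow> real"
  shows "(\<Sum>m=1..p * q. g m) = (\<Sum>i=1..p. \<Sum>j=1..q. g ((i - 1) * q + j))"
proof (induction p)
  case (Suc p)
  have "(\<Sum>m=1..Suc p * q. g m) = (\<Sum>m=1..p * q + q. g m)" by (simp add: add.commute)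
  also have "\<dots> = (\<Sum>m=1..p * q. g m) + (\<Sum>j=1..q. g (p * q + j))"
    using sum_shift_block[of g "p * q" q] by (simp add: add.commute)
  finally show ?case using Suc.IH by simp
qed simp

text \<open>The weights and biases of the layers fill the index range in consecutive blocks, without
  gap or overlap. Sums over layers, as in \<open>Vfun\<close>, thus become sums over coordinates, in
  which squares can be completed term by term.\<close>

lemma sum_params:
  fixes g :: "nat \<Rightarrow> real"
  shows "(\<Sum>m=1..dsum l n. g m) =
    (\<Sum>k<n. (\<Sum>i=1..l (Suc k). \<Sum>j=1..l k. g (widx l k i j)) + (\<Sum>i=1..l (Suc k). g (bidx l k i)))"
proof (induction n)
  case (Suc n)
  have "(\<Sum>m=1..dsum l (Suc n). g m) = (\<Sum>m=1..dsum l n + (l (Suc n) * l n + l (Suc n)). g m)"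
    by (simp add: dsum_Suc add.assoc)
  also have "\<dots> = (\<Sum>m=1..dsum l n. g m)
      + (\<Sum>m=1..l (Suc n) * l n + l (Suc n). g (m + dsum l n))"
    by (rule sum_shift_block)
  also have "(\<Sum>m=1..l (Suc n) * l n + l (Suc n). g (m + dsum l n))
      = (\<Sum>i=1..l (Suc n). \<Sum>j=1..l n. g (widx l n i j)) + (\<Sum>i=1..l (Suc n). g (bidx l n i))"
    unfolding sum_shift_block sum_grid widx_def bidx_def by (simp add: add_ac)
  finally show ?case using Suc.IH by simp
qed simp

text \<open>Distinct weights and biases occupy distinct indices, so their values can be prescribed
  independently. This supplies the coefficient vectors of the Lyapunov function.\<close>

lemma params_exist:
  fixes W :: "nat \<Rightarrow> nat \<Rightarrow> nat \<Rightarrow> real" and b :: "nat \<Rightarrow> nat \<Rightarrow> real"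
  shows "\<exists>\<theta>. \<forall>k<n. \<forall>i\<in>{1..l (Suc k)}. \<theta> (bidx l k i) = b k i \<and>
      (\<forall>j\<in>{1..l k}. \<theta> (widx l k i j) = W k i j)"
proof (induction n)
  case (Suc n)
  then obtain \<theta> where \<theta>: "\<And>k i. k < n \<Longrightarrow> i \<in> {1..l (Suc k)} \<Longrightarrow> \<theta> (bidx l k i) = b k i"
    "\<And>k i j. k < n \<Longrightarrow> i \<in> {1..l (Suc k)} \<Longrightarrow> j \<in> {1..l k} \<Longrightarrow> \<theta> (widx l k i j) = W k i j"
    by blast
  \<comment> \<open>Indices up to \<open>dsum l n\<close> keep their old values. Beyond them rows
    and columns count from 1, so 1 is subtracted before \<open>div\<close> and \<open>mod\<close>
    and added back afterwards.\<close>
  define \<theta>' where "\<theta>' m = (if m \<le> dsum l n then \<theta> m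
     else if m - dsum l n \<le> l (Suc n) * l n
     then W n ((m - dsum l n - 1) div l n + 1) ((m - dsum l n - 1) mod l n + 1)
     else b n (m - dsum l n - l (Suc n) * l n))" for m
  have old: "\<theta>' m = \<theta> m" if "m \<in> {1..dsum l n}" for m
    using that by (simp add: \<theta>'_def)
  have newb: "\<theta>' (bidx l n i) = b n i" if "i \<in> {1..l (Suc n)}" for i
    using that by (auto simp: \<theta>'_def bidx_def)
  have neww: "\<theta>' (widx l n i j) = W n i j" if i: "i \<in> {1..l (Suc n)}" and j: "j \<in> {1..l n}" for i j
  proof -
    have gt: "\<not> widx l n i j \<le> dsum l n" using j by (simp add: widx_def)
    obtain i' j' where ij: "i = Suc i'" "j = Suc j'" "j' < l n"
      using i j by (cases i; cases j) auto
    have "(i' * l n + j') div l n = i'" "(i' * l n + j') mod l n = j'"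
      using ij(3) by auto
    then show ?thesis
      using grid_index_le[OF i j] ij gt by (simp add: \<theta>'_def widx_def)
  qed
  have "\<theta>' (bidx l k i) = b k i \<and> (\<forall>j\<in>{1..l k}. \<theta>' (widx l k i j) = W k i j)"
    if "k < Suc n" "i \<in> {1..l (Suc k)}" for k i
  proof (cases "k = n")
    case False
    with that have k: "k < n" by simp
    with that(2) \<theta> show ?thesis using bidx_mem[where l = l, OF k that(2)] widx_mem[where l = l, OF k that(2)] by (auto simp: old simp del: atLeastAtMost_iff)
  qed (use that newb neww in blast)
  then show ?case by blast
qed simp

section \<open>Differentiation under the integral and along integral paths\<close>

text \<open>The mean value inequality bounds the difference quotients by \<open>K\<close>, a
  constant and hence integrable over a finite measure, so dominated convergence applies along every
  null sequence of increments.\<close>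

lemma integral_has_derivative_under:
  fixes g g' :: "real \<Rightarrow> 'a \<Rightarrow> real"
  assumes fin: "finite_measure M"
    and deriv: "\<And>h x. x \<in> space M \<Longrightarrow> ((\<lambda>h. g h x) has_real_derivative g' h x) (at h)"
    and int: "\<And>h. integrable M (g h)"
    and meas: "\<And>h. g' h \<in> borel_measurable M"
    and bound: "\<And>h x. x \<in> space M \<Longrightarrow> \<bar>h - h0\<bar> \<le> 1 \<Longrightarrow> \<bar>g' h x\<bar> \<le> K"
  shows "((\<lambda>h. \<integral>x. g h x \<partial>M) has_real_derivative (\<integral>x. g' h0 x \<partial>M)) (at h0)"
proof -
  interpret finite_measure M by (rule fin)
  have "((\<lambda>h. ((\<integral>x. g (h0 + h) x \<partial>M) - (\<integral>x. g h0 x \<partial>M)) / h) \<longlongrightarrow> (\<integral>x. g' h0 x \<partial>M)) (at 0)"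
    unfolding tendsto_at_iff_sequentially
  proof (intro allI impI)
    fix X :: "nat \<Rightarrow> real"
    assume X: "\<forall>i. X i \<in> UNIV - {0}" "X \<longlonglongrightarrow> 0"
    obtain N where N: "\<And>n. n \<ge> N \<Longrightarrow> \<bar>X n\<bar> \<le> 1"
      using LIMSEQ_D[OF X(2), of 1] by (force intro: less_imp_le)
    \<comment> \<open>Dropping the first \<open>N\<close> increments keeps all evaluation points in
      the interval on which \<open>K\<close> bounds the derivative.\<close>
    define q where "q n x = (g (h0 + X (n + N)) x - g h0 x) / X (n + N)" for n x
    have X': "(\<lambda>n. X (n + N)) \<longlonglongrightarrow> 0" using X(2) by (rule LIMSEQ_ignore_initial_segment)
    have "(\<lambda>n. \<integral>x. q n x \<partial>M) \<longlonglongrightarrow> (\<integral>x. g' h0 x \<partial>M)"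
    proof (rule integral_dominated_convergence[where w = "\<lambda>_. K"])
      show "AE x in M. (\<lambda>n. q n x) \<longlonglongrightarrow> g' h0 x"
      proof (rule AE_I2)
        fix x assume "x \<in> space M"
        then have "((\<lambda>h. (g (h0 + h) x - g h0 x) / h) \<longlongrightarrow> g' h0 x) (at 0)"
          using deriv[of x h0] by (simp add: DERIV_def)
        then show "(\<lambda>n. q n x) \<longlonglongrightarrow> g' h0 x"
          unfolding tendsto_at_iff_sequentially q_def using X(1) X'
          by (auto simp: comp_def elim!: allE[of _ "\<lambda>n. X (n + N)"])
      qed
      show "AE x in M. norm (q n x) \<le> K" for n
      proof (rule AE_I2)
        fix x assume x: "x \<in> space M"
        have "norm (g (h0 + X (n + N)) x - g h0 x) \<le> K * norm ((h0 + X (n + N)) - h0)"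
        proof (rule field_differentiable_bound[of "{h0 - 1..h0 + 1}" "\<lambda>h. g h x" "\<lambda>h. g' h x"])
          show "((\<lambda>h. g h x) has_real_derivative g' z x) (at z within {h0 - 1..h0 + 1})" for z
            using deriv[OF x] by (rule has_field_derivative_at_within)
          show "norm (g' z x) \<le> K" if "z \<in> {h0 - 1..h0 + 1}" for z
            using that bound[OF x, of z] by (simp add: abs_le_iff)
          show "h0 \<in> {h0 - 1..h0 + 1}" "h0 + X (n + N) \<in> {h0 - 1..h0 + 1}"
            using N[of "n + N"] by (auto simp: abs_le_iff)
        qed simp
        then show "norm (q n x) \<le> K"
          using X(1) by (simp add: q_def divide_le_eq)
      qed
    qed (use int meas in \<open>auto simp: q_def\<close>)
    moreover have "(\<integral>x. q n x \<partial>M) = ((\<integral>x. g (h0 + X (n + N)) x \<partial>M) - (\<integral>x. g h0 x \<partial>M)) / X (n + N)" for n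
      using int by (simp add: q_def)
    ultimately have "(\<lambda>n. ((\<integral>x. g (h0 + X (n + N)) x \<partial>M) - (\<integral>x. g h0 x \<partial>M)) / X (n + N))
        \<longlonglongrightarrow> (\<integral>x. g' h0 x \<partial>M)" by simp
    then show "((\<lambda>h. ((\<integral>x. g (h0 + h) x \<partial>M) - (\<integral>x. g h0 x \<partial>M)) / h) \<circ> X)
        \<longlonglongrightarrow> (\<integral>x. g' h0 x \<partial>M)"
      unfolding comp_def by (rule LIMSEQ_offset)
  qed
  then show ?thesis by (simp add: DERIV_def)
qed

text \<open>The mean value theorem on the segment from \<open>p u\<close> to \<open>p v\<close>
  expresses the increment of \<open>F\<close> by \<open>dF\<close> at one point of the segment,
  paired with the integral of \<open>q\<close>. Replacing that point by \<open>p s\<close> under the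
  integral changes \<open>dF\<close> by at most twice \<epsilon>, both values being close to
  \<open>c\<close>.\<close>

lemma increment_along_path:
  fixes F :: "(nat \<Rightarrow> real) \<Rightarrow> real" and p q :: "real \<Rightarrow> nat \<Rightarrow> real"
  assumes fin: "finite I" and uv: "u \<le> v"
    and deriv: "\<And>\<theta> \<eta> h. ((\<lambda>h. F (\<lambda>m. \<theta> m + h * \<eta> m)) has_real_derivative
        (\<Sum>m\<in>I. dF (\<lambda>m. \<theta> m + h * \<eta> m) m * \<eta> m)) (at h)"
    and q_int: "\<And>m. m \<in> I \<Longrightarrow> (\<lambda>s. q s m) integrable_on {u..v}"
    and dq_int: "\<And>m. m \<in> I \<Longrightarrow> (\<lambda>s. dF (p s) m * q s m) integrable_on {u..v}"
    and q_bound: "\<And>s m. s \<in> {u..v} \<Longrightarrow> m \<in> I \<Longrightarrow> \<bar>q s m\<bar> \<le> M"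
    and path: "\<And>m. m \<in> I \<Longrightarrow> p v m - p u m = integral {u..v} (\<lambda>s. q s m)"
    and segment: "\<And>z m. z \<in> {0..1} \<Longrightarrow> m \<in> I \<Longrightarrow>
        \<bar>dF (\<lambda>m. p u m + z * (p v m - p u m)) m - c m\<bar> \<le> \<epsilon>"
    and near: "\<And>s m. s \<in> {u..v} \<Longrightarrow> m \<in> I \<Longrightarrow> \<bar>dF (p s) m - c m\<bar> \<le> \<epsilon>"
  shows "\<bar>F (p v) - F (p u) - integral {u..v} (\<lambda>s. \<Sum>m\<in>I. dF (p s) m * q s m)\<bar>
      \<le> 2 * \<epsilon> * real (card I) * M * (v - u)"
proof -
  have "\<exists>z. 0 < z \<and> z < (1::real) \<and>
      F (\<lambda>m. p u m + 1 * (p v m - p u m)) - F (\<lambda>m. p u m + 0 * (p v m - p u m)) =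
      (1 - 0) * (\<Sum>m\<in>I. dF (\<lambda>m. p u m + z * (p v m - p u m)) m * (p v m - p u m))"
    by (rule MVT2) (auto intro: deriv)
  then obtain z where z: "0 < z" "z < 1" and
    incr: "F (p v) - F (p u) = (\<Sum>m\<in>I. dF (\<lambda>m. p u m + z * (p v m - p u m)) m * (p v m - p u m))"
    by auto
  define \<zeta> where "\<zeta> = (\<lambda>m. p u m + z * (p v m - p u m))"
  have each: "\<bar>integral {u..v} (\<lambda>s. dF \<zeta> m * q s m - dF (p s) m * q s m)\<bar> \<le> 2 * \<epsilon> * M * (v - u)"
    if m: "m \<in> I" for m
  proof -
    have "norm (integral (cbox u v) (\<lambda>s. dF \<zeta> m * q s m - dF (p s) m * q s m))
        \<le> (2 * \<epsilon> * M) * measure lborel (cbox u v)"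
    proof (rule integrable_bound)
      have e0: "0 \<le> \<epsilon>" using near[of u m] m uv by force
      have M0: "0 \<le> M" using q_bound[of u m] m uv by force
      show "0 \<le> 2 * \<epsilon> * M" using e0 M0 by simp
      show "(\<lambda>s. dF \<zeta> m * q s m - dF (p s) m * q s m) integrable_on cbox u v"
        using q_int[OF m] dq_int[OF m] by (auto intro!: integrable_diff integrable_on_mult_right)
      fix s assume s: "s \<in> cbox u v"
      have "\<bar>dF \<zeta> m - c m\<bar> \<le> \<epsilon>" using segment[of z m] z m by (simp add: \<zeta>_def)
      moreover have "\<bar>dF (p s) m - c m\<bar> \<le> \<epsilon>" using near[of s m] s m by simp
      ultimately have "\<bar>dF \<zeta> m - dF (p s) m\<bar> \<le> 2 * \<epsilon>" by linarith
      then have "\<bar>dF \<zeta> m - dF (p s) m\<bar> * \<bar>q s m\<bar> \<le> 2 * \<epsilon> * M"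
        using q_bound[of s m] s m by (intro mult_mono) auto
      then show "norm (dF \<zeta> m * q s m - dF (p s) m * q s m) \<le> 2 * \<epsilon> * M"
        by (simp add: left_diff_distrib[symmetric] abs_mult)
    qed
    then show ?thesis using uv by simp
  qed
  have "F (p v) - F (p u) = (\<Sum>m\<in>I. integral {u..v} (\<lambda>s. dF \<zeta> m * q s m))"
    unfolding incr \<zeta>_def[symmetric] using path by simp
  moreover have "integral {u..v} (\<lambda>s. \<Sum>m\<in>I. dF (p s) m * q s m)
      = (\<Sum>m\<in>I. integral {u..v} (\<lambda>s. dF (p s) m * q s m))"
    using fin dq_int by (rule integral_sum)
  ultimately have "F (p v) - F (p u) - integral {u..v} (\<lambda>s. \<Sum>m\<in>I. dF (p s) m * q s m)
      = (\<Sum>m\<in>I. integral {u..v} (\<lambda>s. dF \<zeta> m * q s m - dF (p s) m * q s m))"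
    using q_int dq_int by (simp add: sum_subtractf integral_diff integrable_on_mult_right)
  also have "\<bar>\<dots>\<bar> \<le> (\<Sum>m\<in>I. 2 * \<epsilon> * M * (v - u))"
    by (rule order_trans[OF sum_abs sum_mono]) (rule each)
  finally show ?thesis by (simp add: algebra_simps)
qed

text \<open>With a discontinuous \<open>q\<close> the path need not be differentiable. Still,
  \<open>F (p t)\<close> minus the integral of the expected derivative has increments of order o(v -
  u) at every time, so this difference has derivative zero and is constant.\<close>

lemma chain_rule_integral_path:
  fixes F :: "(nat \<Rightarrow> real) \<Rightarrow> real" and dF :: "(nat \<Rightarrow> real) \<Rightarrow> nat \<Rightarrow> real"
    and p q :: "real \<Rightarrow> nat \<Rightarrow> real"
  assumes fin: "finite I" and T: "0 \<le> T"
    and deriv: "\<And>\<theta> \<eta> h. ((\<lambda>h. F (\<lambda>m. \<theta> m + h * \<eta> m)) has_real_derivative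
        (\<Sum>m\<in>I. dF (\<lambda>m. \<theta> m + h * \<eta> m) m * \<eta> m)) (at h)"
    and cont: "\<And>X \<theta> m. (\<And>m. m \<in> I \<Longrightarrow> (\<lambda>n. X n m) \<longlonglongrightarrow> \<theta> m) \<Longrightarrow> m \<in> I \<Longrightarrow>
        (\<lambda>n. dF (X n) m) \<longlonglongrightarrow> dF \<theta> m"
    and q_int: "\<And>m. m \<in> I \<Longrightarrow> (\<lambda>s. q s m) absolutely_integrable_on {0..T}"
    and q_bound: "\<And>s m. s \<in> {0..T} \<Longrightarrow> m \<in> I \<Longrightarrow> \<bar>q s m\<bar> \<le> M"
    and path: "\<And>t m. t \<in> {0..T} \<Longrightarrow> m \<in> I \<Longrightarrow> p t m = p 0 m + integral {0..t} (\<lambda>s. q s m)"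
  shows "(\<lambda>s. \<Sum>m\<in>I. dF (p s) m * q s m) absolutely_integrable_on {0..T}" (is ?int)
    and "F (p T) = F (p 0) + integral {0..T} (\<lambda>s. \<Sum>m\<in>I. dF (p s) m * q s m)" (is ?eq)
proof -
  have qi: "(\<lambda>s. q s m) integrable_on {0..T}" if "m \<in> I" for m
    using q_int[OF that] by (simp add: absolutely_integrable_on_def)
  have p_cont: "continuous_on {0..T} (\<lambda>t. p t m)" if m: "m \<in> I" for m
  proof -
    have "continuous_on {0..T} (\<lambda>t. p 0 m + integral {0..t} (\<lambda>s. q s m))"
      by (intro continuous_intros indefinite_integral_continuous_1 qi m)
    then show ?thesis by (rule continuous_on_eq) (rule path[OF _ m, symmetric])
  qed
  have dF_cont: "continuous_on {0..T} (\<lambda>t. dF (p t) m)" if m: "m \<in> I" for m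
    unfolding continuous_on_sequentially comp_def
  proof (intro allI ballI impI, elim conjE)
    fix x :: "nat \<Rightarrow> real" and t
    assume t: "t \<in> {0..T}" "\<forall>n. x n \<in> {0..T}" "x \<longlonglongrightarrow> t"
    show "(\<lambda>n. dF (p (x n)) m) \<longlonglongrightarrow> dF (p t) m"
      by (rule cont[OF _ m], rule continuous_on_tendsto_compose[OF p_cont t(3)]) (use t in auto)
  qed
  have prod_int: "(\<lambda>s. dF (p s) m * q s m) absolutely_integrable_on {0..T}" if m: "m \<in> I" for m
  proof (rule absolutely_integrable_bounded_measurable_product_real)
    show "bounded ((\<lambda>s. dF (p s) m) ` {0..T})"
      by (intro compact_imp_bounded compact_continuous_image dF_cont m) simp
    show "(\<lambda>s. dF (p s) m) \<in> borel_measurable (lebesgue_on {0..T})"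
      by (intro continuous_imp_measurable_on_sets_lebesgue dF_cont m) simp
  qed (use q_int m in auto)
  show ?int using fin prod_int by (rule absolutely_integrable_sum)
  define w where "w s = (\<Sum>m\<in>I. dF (p s) m * q s m)" for s
  have wi: "w integrable_on {0..T}"
    using \<open>?int\<close> by (simp add: absolutely_integrable_on_def w_def[abs_def])
  have sub: "f integrable_on {u..v}" if "f integrable_on {0..T}" "0 \<le> u" "v \<le> T" for f :: "real \<Rightarrow> real" and u v
    by (rule integrable_on_subinterval[OF that(1)]) (use that in auto)
  have comb: "integral {0..v} f - integral {0..u} f = integral {u..v} f"
    if "f integrable_on {0..T}" "0 \<le> u" "u \<le> v" "v \<le> T" for f :: "real \<Rightarrow> real" and u v
    using Henstock_Kurzweil_Integration.integral_combine[where a = 0 and c = u and b = v and f = f] sub[OF that(1), of 0 v] that by simp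
  define \<Phi> where "\<Phi> t = F (p t) - integral {0..t} w" for t
  have "(\<Phi> has_real_derivative 0) (at t within {0..T})" if t: "t \<in> {0..T}" for t
    unfolding has_field_derivative_def has_derivative_within_alt
  proof (intro conjI allI impI)
    fix e :: real assume e: "e > 0"
    \<comment> \<open>\<open>M\<close> may be negative when \<open>I\<close> is empty. The summand 1
      in the next definition keeps the denominator positive.\<close>
    define M' where "M' = max M 0"
    define \<epsilon> where "\<epsilon> = e / (2 * real (card I) * M' + 1)"
    have den: "2 * real (card I) * M' + 1 > 0"
      by (intro add_nonneg_pos) (auto simp: M'_def)
    have \<epsilon>: "\<epsilon> > 0" using e den by (simp add: \<epsilon>_def)
    have "\<epsilon> * (2 * real (card I) * M') \<le> \<epsilon> * (2 * real (card I) * M' + 1)"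
      using \<epsilon> by (intro mult_left_mono) auto
    also have "\<dots> = e" using den by (simp add: \<epsilon>_def)
    finally have \<epsilon>e: "2 * \<epsilon> * real (card I) * M' \<le> e" by (simp add: mult_ac)
    have "\<forall>\<^sub>F s in at t within {0..T}. \<forall>m\<in>I. \<forall>z\<in>{0..1}.
        \<bar>dF (\<lambda>m. p t m + z * (p s m - p t m)) m - dF (p t) m\<bar> \<le> \<epsilon>"
    proof (rule eventually_ball_finite[OF fin], rule ballI)
      fix m assume m: "m \<in> I"
      define P where "P s z \<longleftrightarrow> \<bar>dF (\<lambda>m. p t m + z * (p s m - p t m)) m - dF (p t) m\<bar> \<le> \<epsilon>" for s z
      show "\<forall>\<^sub>F s in at t within {0..T}. \<forall>z\<in>{0..1}.
          \<bar>dF (\<lambda>m. p t m + z * (p s m - p t m)) m - dF (p t) m\<bar> \<le> \<epsilon>"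
        unfolding P_def[symmetric]
      proof (rule sequentially_imp_eventually_within, intro allI impI, elim conjE)
        fix x assume x: "\<forall>n. x n \<in> {0..T} \<and> x n \<noteq> t" "x \<longlonglongrightarrow> t"
        \<comment> \<open>Uniformity in \<open>z\<close> is extracted from sequential continuity:
          \<open>z n\<close> is a point violating the estimate whenever there is one, so convergence
          along this worst choice gives the estimate for all \<open>z\<close>.\<close>
        have "\<exists>z. z \<in> {0..1} \<and> (P (x n) z \<longrightarrow> (\<forall>z\<in>{0..1}. P (x n) z))" for n
          by (cases "\<forall>z\<in>{0..1}. P (x n) z") (auto intro: exI[of _ 0])
        then obtain z where z_mem: "\<And>n. z n \<in> {0..1}"
          and worst: "\<And>n. P (x n) (z n) \<Longrightarrow> \<forall>z\<in>{0..1}. P (x n) z"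
          by metis
        have "(\<lambda>n. dF (\<lambda>m. p t m + z n * (p (x n) m - p t m)) m) \<longlonglongrightarrow> dF (p t) m"
        proof (rule cont[OF _ m])
          fix m assume m: "m \<in> I"
          have "(\<lambda>n. p (x n) m) \<longlonglongrightarrow> p t m"
            by (rule continuous_on_tendsto_compose[OF p_cont[OF m] x(2)]) (use t x in auto)
          then have "(\<lambda>n. p (x n) m - p t m) \<longlonglongrightarrow> 0" by (simp add: LIM_zero)
          then have "(\<lambda>n. z n * (p (x n) m - p t m)) \<longlonglongrightarrow> 0"
            by (rule tendsto_0_le[where K = 1]) (use z_mem in \<open>simp add: abs_mult mult_left_le_one_le\<close>)
          then show "(\<lambda>n. p t m + z n * (p (x n) m - p t m)) \<longlonglongrightarrow> p t m"
            using tendsto_add[OF tendsto_const] by fastforce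
        qed
        then have "\<forall>\<^sub>F n in sequentially. dist (dF (\<lambda>m. p t m + z n * (p (x n) m - p t m)) m) (dF (p t) m) < \<epsilon>"
          using \<epsilon> by (rule tendstoD)
        then show "\<forall>\<^sub>F n in sequentially. \<forall>z\<in>{0..1}. P (x n) z"
          by eventually_elim (intro worst, simp add: P_def dist_real_def)
      qed
    qed
    then obtain d where d: "d > 0" and seg': "\<And>s m z. s \<in> {0..T} \<Longrightarrow> s \<noteq> t \<Longrightarrow> \<bar>s - t\<bar> < d \<Longrightarrow> m \<in> I \<Longrightarrow>
        z \<in> {0..1} \<Longrightarrow> \<bar>dF (\<lambda>m. p t m + z * (p s m - p t m)) m - dF (p t) m\<bar> \<le> \<epsilon>"
      unfolding eventually_at dist_real_def by blast
    have seg: "\<bar>dF (\<lambda>m. p t m + z * (p s m - p t m)) m - dF (p t) m\<bar> \<le> \<epsilon>"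
      if "s \<in> {0..T}" "\<bar>s - t\<bar> < d" "m \<in> I" "z \<in> {0..1}" for s m z
      using seg'[OF that(1) _ that(2-)] \<epsilon> by (cases "s = t") auto
    have near: "\<bar>dF (p s) m - dF (p t) m\<bar> \<le> \<epsilon>" if "s \<in> {0..T}" "\<bar>s - t\<bar> < d" "m \<in> I" for s m
      using seg[OF that, of 1] by simp
    \<comment> \<open>A derivative at \<open>t\<close> compares values with the one at
      \<open>t\<close>, so one endpoint is always \<open>t\<close>; both one-sided cases are treated
      together.\<close>
    have incr: "\<bar>\<Phi> v - \<Phi> u\<bar> \<le> e * (v - u)"
      if uv: "u \<in> {0..T}" "v \<in> {0..T}" "u \<le> v" and end_pt: "t = u \<and> \<bar>v - t\<bar> < d \<or> t = v \<and> \<bar>u - t\<bar> < d" for u v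
    proof -
      have "\<bar>F (p v) - F (p u) - integral {u..v} (\<lambda>s. \<Sum>m\<in>I. dF (p s) m * q s m)\<bar>
        \<le> 2 * \<epsilon> * real (card I) * M' * (v - u)"
      proof (rule increment_along_path[where c = "dF (p t)"])
        show "p v m - p u m = integral {u..v} (\<lambda>s. q s m)" if "m \<in> I" for m
        proof -
          have "integral {0..v} (\<lambda>s. q s m) - integral {0..u} (\<lambda>s. q s m) = integral {u..v} (\<lambda>s. q s m)"
            by (rule comb[OF qi[OF that]]) (use uv in auto)
          then show ?thesis using path[OF uv(1) that] path[OF uv(2) that] by linarith
        qed
        show "\<bar>dF (\<lambda>m. p u m + z * (p v m - p u m)) m - dF (p t) m\<bar> \<le> \<epsilon>" if zm: "z \<in> {0..1}" "m \<in> I" for z m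
        proof -
          consider "t = u" "\<bar>v - t\<bar> < d" | "t = v" "\<bar>u - t\<bar> < d" using end_pt by blast
          then show ?thesis
          proof cases
            case 1
            then show ?thesis using seg[of v m z] uv zm by simp
          next
            case 2
            \<comment> \<open>The estimate \<open>seg\<close> is for segments that start at
              \<open>p t\<close>. Here \<open>t\<close> is the right endpoint, so the segment is
              traversed backwards.\<close>
            have "p u m + z * (p v m - p u m) = p t m + (1 - z) * (p u m - p t m)" for m
              using 2 by (simp add: algebra_simps)
            then show ?thesis using seg[of u m "1 - z"] 2 uv zm by simp
          qed
        qed
        show "\<bar>dF (p s) m - dF (p t) m\<bar> \<le> \<epsilon>" if "s \<in> {u..v}" "m \<in> I" for s m
          using near[of s m] that end_pt uv by auto
        show "\<bar>q s m\<bar> \<le> M'" if "s \<in> {u..v}" "m \<in> I" for s m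
          using q_bound[of s m] that uv by (simp add: M'_def)
        show "(\<lambda>s. dF (p s) m * q s m) integrable_on {u..v}" if "m \<in> I" for m
          by (rule sub) (use prod_int[OF that] uv in \<open>auto simp: absolutely_integrable_on_def\<close>)
        show "(\<lambda>s. q s m) integrable_on {u..v}" if "m \<in> I" for m
          by (rule sub[OF qi[OF that]]) (use uv in auto)
      qed (rule fin uv(3) deriv)+
      also have "\<dots> \<le> e * (v - u)" using \<epsilon>e uv by (intro mult_right_mono) auto
      finally have "\<bar>F (p v) - F (p u) - integral {u..v} w\<bar> \<le> e * (v - u)"
        by (simp only: w_def[abs_def])
      moreover have "integral {0..v} w - integral {0..u} w = integral {u..v} w"
        by (rule comb[OF wi]) (use uv in auto)
      ultimately show ?thesis unfolding \<Phi>_def by (simp add: algebra_simps)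
    qed
    have "norm (\<Phi> y - \<Phi> t - 0 * (y - t)) \<le> e * norm (y - t)" if y: "y \<in> {0..T}" "norm (y - t) < d" for y
    proof (cases "t \<le> y")
      case True
      then show ?thesis using incr[OF t y(1) True] y by simp
    next
      case False
      then show ?thesis using incr[OF y(1) t] y by (simp add: abs_minus_commute)
    qed
    with d show "\<exists>d>0. \<forall>y\<in>{0..T}. norm (y - t) < d \<longrightarrow> norm (\<Phi> y - \<Phi> t - 0 * (y - t)) \<le> e * norm (y - t)"
      by blast
  qed (rule bounded_linear_mult_right)
  then obtain c where "\<And>t. t \<in> {0..T} \<Longrightarrow> \<Phi> t = c"
    using has_field_derivative_zero_constant[of "{0..T}" \<Phi>] by auto
  then have "\<Phi> T = \<Phi> 0" using T by simp
  then show ?eq by (simp add: \<Phi>_def w_def[abs_def])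
qed

section \<open>Directional derivatives of realizations\<close>

text \<open>Giving the unused activation of index 0 the value \<open>id\<close> turns the recursion of
  \<^const>\<open>realization\<close> into a uniform one that starts at index 0.\<close>

lemma realization_Suc:
  assumes "act 0 = (\<lambda>y. y)" "i \<in> {1..l (Suc k)}"
  shows "realization l act \<theta> (Suc k) x i =
    \<theta> (bidx l k i) + (\<Sum>j=1..l k. \<theta> (widx l k i j) * act k (realization l act \<theta> k x j))"
  using assms by (cases k) (auto simp: affine_layer_def wgt_Suc bias_Suc)

text \<open>From the first layer on the recursion evaluates only \<open>act k\<close> with
  \<open>k\<close> positive, so \<open>act 0\<close> can be chosen freely.\<close>

lemma realization_cong_act:
  assumes "\<And>k. k \<ge> 1 \<Longrightarrow> act k = act' k"
  shows "realization l act \<theta> k x = realization l act' \<theta> k x"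
proof (induction k)
  case (Suc k)
  then show ?case by (cases k) (simp_all add: assms)
qed simp

text \<open>The derivative of the realization at \<open>\<theta>\<close> in direction \<open>\<eta>\<close>, propagated forwards through
  the layers; \<open>act'\<close> stands for the derivatives of the activations.\<close>

primrec tangent :: "(nat \<Rightarrow> nat) \<Rightarrow> (nat \<Rightarrow> real \<Rightarrow> real) \<Rightarrow> (nat \<Rightarrow> real \<Rightarrow> real) \<Rightarrow> (nat \<Rightarrow> real)
    \<Rightarrow> (nat \<Rightarrow> real) \<Rightarrow> nat \<Rightarrow> (nat \<Rightarrow> real) \<Rightarrow> nat \<Rightarrow> real" where
  "tangent l act act' \<theta> \<eta> 0 x = (\<lambda>i. 0)"
| "tangent l act act' \<theta> \<eta> (Suc k) x = (\<lambda>i. \<eta> (bidx l k i) +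
     (\<Sum>j=1..l k. \<eta> (widx l k i j) * act k (realization l act \<theta> k x j) +
        \<theta> (widx l k i j) * (act' k (realization l act \<theta> k x j) * tangent l act act' \<theta> \<eta> k x j)))"

text \<open>Majorants from taking absolute values in the recursions: \<open>K\<close> bounds the
  parameters, \<open>X\<close> the inputs, \<open>C\<close> the activation derivatives, and 1 the
  entries of the direction. The regularization parameter does not occur, which makes them dominating
  constants.\<close>

primrec realization_bound :: "(nat \<Rightarrow> nat) \<Rightarrow> real \<Rightarrow> real \<Rightarrow> nat \<Rightarrow> real" where
  "realization_bound l K X 0 = X"
| "realization_bound l K X (Suc k) = K + real (l k) * (K * realization_bound l K X k)"

primrec tangent_bound :: "(nat \<Rightarrow> nat) \<Rightarrow> real \<Rightarrow> real \<Rightarrow> real \<Rightarrow> nat \<Rightarrow> real" where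
  "tangent_bound l K X C 0 = 0"
| "tangent_bound l K X C (Suc k) =
     1 + real (l k) * (realization_bound l K X k + K * (C * tangent_bound l K X C k))"

lemma realization_bound_nonneg: "0 \<le> K \<Longrightarrow> 0 \<le> X \<Longrightarrow> 0 \<le> realization_bound l K X k"
  by (induction k) auto

lemma abs_realization_le:
  assumes act: "act 0 = (\<lambda>y. y)" "\<And>k y. \<bar>act k y\<bar> \<le> \<bar>y\<bar>"
    and \<theta>: "\<And>m. m \<in> {1..dsum l n} \<Longrightarrow> \<bar>\<theta> m\<bar> \<le> K" and x: "\<And>j. j \<in> {1..l 0} \<Longrightarrow> \<bar>x j\<bar> \<le> X"
    and nonneg: "0 \<le> K" "0 \<le> X" and ki: "k \<le> n" "i \<in> {1..l k}"
  shows "\<bar>realization l act \<theta> k x i\<bar> \<le> realization_bound l K X k"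
  using ki
proof (induction k arbitrary: i)
  case (Suc k)
  have k: "k < n" "k \<le> n" using Suc.prems by simp_all
  note b = \<theta>[OF bidx_mem[where l = l, OF k(1) Suc.prems(2)]]
  have w: "\<bar>\<theta> (widx l k i j) * act k (realization l act \<theta> k x j)\<bar> \<le> K * realization_bound l K X k"
    if j: "j \<in> {1..l k}" for j
  proof -
    have "\<bar>\<theta> (widx l k i j)\<bar> \<le> K" by (rule \<theta>[OF widx_mem[where l = l, OF k(1) Suc.prems(2) j]])
    moreover have "\<bar>act k (realization l act \<theta> k x j)\<bar> \<le> realization_bound l K X k"
      by (rule order_trans[OF act(2) Suc.IH[OF k(2) j]])
    ultimately show ?thesis unfolding abs_mult using nonneg by (intro mult_mono) auto
  qed
  have "\<bar>\<Sum>j=1..l k. \<theta> (widx l k i j) * act k (realization l act \<theta> k x j)\<bar>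
      \<le> (\<Sum>j=1..l k. K * realization_bound l K X k)"
    by (rule order_trans[OF sum_abs sum_mono]) (rule w)
  then have "\<bar>\<Sum>j=1..l k. \<theta> (widx l k i j) * act k (realization l act \<theta> k x j)\<bar>
      \<le> real (l k) * (K * realization_bound l K X k)" by simp
  with b show ?case
    unfolding realization_Suc[where l = l and act = act, OF act(1) Suc.prems(2)] realization_bound.simps by linarith
qed (simp add: x)

lemma abs_tangent_le:
  assumes act: "act 0 = (\<lambda>y. y)" "\<And>k y. \<bar>act k y\<bar> \<le> \<bar>y\<bar>" and act': "\<And>k y. \<bar>act' k y\<bar> \<le> C"
    and \<theta>: "\<And>m. m \<in> {1..dsum l n} \<Longrightarrow> \<bar>\<theta> m\<bar> \<le> K" and \<eta>: "\<And>m. m \<in> {1..dsum l n} \<Longrightarrow> \<bar>\<eta> m\<bar> \<le> 1"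
    and x: "\<And>j. j \<in> {1..l 0} \<Longrightarrow> \<bar>x j\<bar> \<le> X"
    and nonneg: "0 \<le> K" "0 \<le> X" and ki: "k \<le> n" "i \<in> {1..l k}"
  shows "\<bar>tangent l act act' \<theta> \<eta> k x i\<bar> \<le> tangent_bound l K X C k"
  using ki
proof (induction k arbitrary: i)
  case (Suc k)
  have k: "k < n" "k \<le> n" using Suc.prems by simp_all
  have C: "0 \<le> C" using act'[of 0 0] by linarith
  note b = \<eta>[OF bidx_mem[where l = l, OF k(1) Suc.prems(2)]]
  let ?term = "\<lambda>j. \<eta> (widx l k i j) * act k (realization l act \<theta> k x j) +
      \<theta> (widx l k i j) * (act' k (realization l act \<theta> k x j) * tangent l act act' \<theta> \<eta> k x j)"
  have w: "\<bar>?term j\<bar> \<le> 1 * realization_bound l K X k + K * (C * tangent_bound l K X C k)"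
    if j: "j \<in> {1..l k}" for j
  proof -
    note idx = widx_mem[where l = l, OF k(1) Suc.prems(2) j]
    have "\<bar>realization l act \<theta> k x j\<bar> \<le> realization_bound l K X k"
      using act \<theta> x nonneg k(2) j by (rule abs_realization_le)
    then have "\<bar>act k (realization l act \<theta> k x j)\<bar> \<le> realization_bound l K X k"
      by (rule order_trans[OF act(2)])
    then have "\<bar>\<eta> (widx l k i j)\<bar> * \<bar>act k (realization l act \<theta> k x j)\<bar> \<le> 1 * realization_bound l K X k"
      using \<eta>[OF idx] by (intro mult_mono) auto
    moreover have "\<bar>\<theta> (widx l k i j)\<bar> * (\<bar>act' k (realization l act \<theta> k x j)\<bar> * \<bar>tangent l act act' \<theta> \<eta> k x j\<bar>)
        \<le> K * (C * tangent_bound l K X C k)"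
      using \<theta>[OF idx] act' Suc.IH[OF k(2) j] nonneg C by (intro mult_mono) auto
    ultimately show ?thesis
      using abs_triangle_ineq[of "\<eta> (widx l k i j) * act k (realization l act \<theta> k x j)"
          "\<theta> (widx l k i j) * (act' k (realization l act \<theta> k x j) * tangent l act act' \<theta> \<eta> k x j)"]
      unfolding abs_mult by linarith
  qed
  have "\<bar>\<Sum>j=1..l k. ?term j\<bar> \<le> (\<Sum>j=1..l k. 1 * realization_bound l K X k + K * (C * tangent_bound l K X C k))"
    by (rule order_trans[OF sum_abs sum_mono]) (rule w)
  then have "\<bar>\<Sum>j=1..l k. ?term j\<bar> \<le> real (l k) * (realization_bound l K X k + K * (C * tangent_bound l K X C k))"
    by simp
  with b show ?case unfolding tangent.simps tangent_bound.simps by linarith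
qed simp

text \<open>The tangent recursion is linear in the direction, so bounds and limits are needed only
  for unit vectors, whose tangents are the partial derivatives.\<close>

lemma tangent_linear:
  assumes "k \<le> n" "i \<in> {1..l k}"
  shows "tangent l act act' \<theta> \<eta> k x i =
    (\<Sum>m=1..dsum l n. \<eta> m * tangent l act act' \<theta> (\<lambda>p. if p = m then 1 else 0) k x i)"
  using assms
proof (induction k arbitrary: i)
  case (Suc k)
  have k: "k < n" using Suc.prems by simp
  let ?e = "\<lambda>m p. if p = m then 1 else (0::real)"
  have pick: "\<eta> p = (\<Sum>m=1..dsum l n. \<eta> m * ?e m p)" if "p \<in> {1..dsum l n}" for p
    using that by (simp add: if_distrib cong: if_cong)
  have IH: "tangent l act act' \<theta> \<eta> k x j = (\<Sum>m=1..dsum l n. \<eta> m * tangent l act act' \<theta> (?e m) k x j)"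
    if "j \<in> {1..l k}" for j
    using Suc.IH[OF _ that] k by simp
  have "tangent l act act' \<theta> \<eta> (Suc k) x i = (\<Sum>m=1..dsum l n. \<eta> m * ?e m (bidx l k i)) +
     (\<Sum>j=1..l k. (\<Sum>m=1..dsum l n. \<eta> m * ?e m (widx l k i j)) * act k (realization l act \<theta> k x j) +
        \<theta> (widx l k i j) * (act' k (realization l act \<theta> k x j) *
          (\<Sum>m=1..dsum l n. \<eta> m * tangent l act act' \<theta> (?e m) k x j)))"
    unfolding tangent.simps
    using pick[OF bidx_mem[where l = l, OF k Suc.prems(2)]] pick[OF widx_mem[where l = l, OF k Suc.prems(2)]] IH
    by (intro arg_cong2[where f = "(+)"] sum.cong) auto
  also have "\<dots> = (\<Sum>m=1..dsum l n. \<eta> m * ?e m (bidx l k i)) + (\<Sum>m=1..dsum l n. \<Sum>j=1..l k.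
      \<eta> m * (?e m (widx l k i j) * act k (realization l act \<theta> k x j) +
        \<theta> (widx l k i j) * (act' k (realization l act \<theta> k x j) * tangent l act act' \<theta> (?e m) k x j)))"
    by (subst sum.swap) (simp only: sum_distrib_left sum_distrib_right sum.distrib[symmetric] distrib_left mult_ac)
  also have "\<dots> = (\<Sum>m=1..dsum l n. \<eta> m * tangent l act act' \<theta> (?e m) (Suc k) x i)"
    by (simp only: tangent.simps distrib_left sum.distrib sum_distrib_left)
  finally show ?case .
qed simp

lemma realization_has_derivative:
  assumes act0: "act 0 = (\<lambda>y. y)"
    and act: "\<And>k y. (act k has_real_derivative act' k y) (at y)"
    and i: "i \<in> {1..l k}"
  shows "((\<lambda>h. realization l act (\<lambda>m. \<theta> m + h * \<eta> m) k x i) has_real_derivative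
      tangent l act act' (\<lambda>m. \<theta> m + h * \<eta> m) \<eta> k x i) (at h)"
  using i
proof (induction k arbitrary: i)
  case (Suc k)
  note [derivative_intros] = DERIV_chain2[OF act] Suc.IH
  show ?case
    unfolding realization_Suc[where l = l and act = act, OF act0 Suc.prems] tangent.simps
    by (auto intro!: derivative_eq_intros sum.cong simp: algebra_simps)
qed simp

text \<open>The activations and their derivatives are required to converge only along the actual
  inputs of the units, and only once these inputs converge. This weak form matters because the
  limiting derivative may jump. It covers both moving parameters with fixed activations and fixed
  parameters with vanishing regularization.\<close>

lemma realization_tangent_tendsto:
  assumes act0: "\<And>n. act n 0 = (\<lambda>y. y)" "act\<^sub>0 0 = (\<lambda>y. y)"
    and \<theta>: "\<And>m. m \<in> {1..dsum l N} \<Longrightarrow> ((\<lambda>n. \<theta> n m) \<longlongrightarrow> \<theta>\<^sub>0 m) F"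
    and act: "\<And>k j. k < N \<Longrightarrow> j \<in> {1..l k} \<Longrightarrow>
        ((\<lambda>n. realization l (act n) (\<theta> n) k x j) \<longlongrightarrow> realization l act\<^sub>0 \<theta>\<^sub>0 k x j) F \<Longrightarrow>
        ((\<lambda>n. act n k (realization l (act n) (\<theta> n) k x j)) \<longlongrightarrow> act\<^sub>0 k (realization l act\<^sub>0 \<theta>\<^sub>0 k x j)) F"
    and act': "\<And>k j. k < N \<Longrightarrow> j \<in> {1..l k} \<Longrightarrow>
        ((\<lambda>n. realization l (act n) (\<theta> n) k x j) \<longlongrightarrow> realization l act\<^sub>0 \<theta>\<^sub>0 k x j) F \<Longrightarrow>
        ((\<lambda>n. act' n k (realization l (act n) (\<theta> n) k x j)) \<longlongrightarrow> act'\<^sub>0 k (realization l act\<^sub>0 \<theta>\<^sub>0 k x j)) F"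
    and k: "k \<le> N" and i: "i \<in> {1..l k}"
  shows "((\<lambda>n. realization l (act n) (\<theta> n) k x i) \<longlongrightarrow> realization l act\<^sub>0 \<theta>\<^sub>0 k x i) F"
    and "((\<lambda>n. tangent l (act n) (act' n) (\<theta> n) \<eta> k x i) \<longlongrightarrow> tangent l act\<^sub>0 act'\<^sub>0 \<theta>\<^sub>0 \<eta> k x i) F"
proof -
  have "((\<lambda>n. realization l (act n) (\<theta> n) k x i) \<longlongrightarrow> realization l act\<^sub>0 \<theta>\<^sub>0 k x i) F \<and>
    ((\<lambda>n. tangent l (act n) (act' n) (\<theta> n) \<eta> k x i) \<longlongrightarrow> tangent l act\<^sub>0 act'\<^sub>0 \<theta>\<^sub>0 \<eta> k x i) F"
    using k i
  proof (induction k arbitrary: i)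
    case (Suc k)
    have k: "k < N" "k \<le> N" using Suc.prems by simp_all
    note \<theta>' = \<theta>[OF bidx_mem[where l = l, OF k(1) Suc.prems(2)]]
      \<theta>[OF widx_mem[where l = l, OF k(1) Suc.prems(2)]]
    have IH: "((\<lambda>n. realization l (act n) (\<theta> n) k x j) \<longlongrightarrow> realization l act\<^sub>0 \<theta>\<^sub>0 k x j) F"
      "((\<lambda>n. tangent l (act n) (act' n) (\<theta> n) \<eta> k x j) \<longlongrightarrow> tangent l act\<^sub>0 act'\<^sub>0 \<theta>\<^sub>0 \<eta> k x j) F"
      if "j \<in> {1..l k}" for j
      using Suc.IH[OF k(2) that] by auto
    have step: "realization l (act n) (\<theta> n) (Suc k) x i = \<theta> n (bidx l k i) +
        (\<Sum>j=1..l k. \<theta> n (widx l k i j) * act n k (realization l (act n) (\<theta> n) k x j))" for n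
      by (rule realization_Suc[where l = l and act = "act n", OF act0(1) Suc.prems(2)])
    show ?case
      unfolding step realization_Suc[where l = l and act = act\<^sub>0, OF act0(2) Suc.prems(2)] tangent.simps
      by (intro conjI tendsto_intros \<theta>' IH act act' k)
  qed simp
  then show "((\<lambda>n. realization l (act n) (\<theta> n) k x i) \<longlongrightarrow> realization l act\<^sub>0 \<theta>\<^sub>0 k x i) F"
    "((\<lambda>n. tangent l (act n) (act' n) (\<theta> n) \<eta> k x i) \<longlongrightarrow> tangent l act\<^sub>0 act'\<^sub>0 \<theta>\<^sub>0 \<eta> k x i) F"
    by blast+
qed

lemma realization_tangent_measurable:
  assumes act0: "act 0 = (\<lambda>y. y)"
    and act: "\<And>k. act k \<in> borel_measurable borel" and act': "\<And>k. act' k \<in> borel_measurable borel"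
    and x: "\<And>j. j \<in> {1..l 0} \<Longrightarrow> (\<lambda>x. x j) \<in> borel_measurable M"
    and i: "i \<in> {1..l k}"
  shows "(\<lambda>x. realization l act \<theta> k x i) \<in> borel_measurable M"
    and "(\<lambda>x. tangent l act act' \<theta> \<eta> k x i) \<in> borel_measurable M"
proof -
  have "(\<lambda>x. realization l act \<theta> k x i) \<in> borel_measurable M \<and>
      (\<lambda>x. tangent l act act' \<theta> \<eta> k x i) \<in> borel_measurable M"
    using i
  proof (induction k arbitrary: i)
    case (Suc k)
    then show ?case
      unfolding realization_Suc[where l = l and act = act, OF act0 Suc.prems] tangent.simps
      by (intro conjI borel_measurable_add borel_measurable_sum borel_measurable_times borel_measurable_const
        measurable_compose[OF _ act] measurable_compose[OF _ act']) auto
  qed (simp add: x)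
  then show "(\<lambda>x. realization l act \<theta> k x i) \<in> borel_measurable M"
    "(\<lambda>x. tangent l act act' \<theta> \<eta> k x i) \<in> borel_measurable M" by blast+
qed

section \<open>Convergence of the regularized networks\<close>

text \<open>What the regularized and the ReLU activations share: enough for bounds, measurability
  and domination, without any differentiability.\<close>

definition admissible :: "real \<Rightarrow> (nat \<Rightarrow> real \<Rightarrow> real) \<Rightarrow> (nat \<Rightarrow> real \<Rightarrow> real) \<Rightarrow> bool" where
  "admissible C act act' \<longleftrightarrow> act 0 = (\<lambda>y. y) \<and> (\<forall>k y. \<bar>act k y\<bar> \<le> \<bar>y\<bar>) \<and> (\<forall>k y. \<bar>act' k y\<bar> \<le> C) \<and>
     (\<forall>k. act k \<in> borel_measurable borel) \<and> (\<forall>k. act' k \<in> borel_measurable borel)"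

definition relu_act :: "nat \<Rightarrow> real \<Rightarrow> real" where
  "relu_act k = (if k = 0 then (\<lambda>y. y) else (\<lambda>y. max y 0))"

text \<open>The value 0 at the kink is the one the limit selects: regularized derivatives vanish on
  a whole neighbourhood of 0.\<close>

definition relu_act' :: "nat \<Rightarrow> real \<Rightarrow> real" where
  "relu_act' k = (if k = 0 then (\<lambda>y. 1) else (\<lambda>y. if y > 0 then 1 else 0))"

definition reg_act :: "(real \<Rightarrow> real \<Rightarrow> real) \<Rightarrow> real \<Rightarrow> nat \<Rightarrow> real \<Rightarrow> real" where
  "reg_act R r k = (if k = 0 then (\<lambda>y. y) else R (r powr (1 / real k)))"

definition reg_act' :: "(real \<Rightarrow> real \<Rightarrow> real) \<Rightarrow> real \<Rightarrow> nat \<Rightarrow> real \<Rightarrow> real" where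
  "reg_act' R r k = (if k = 0 then (\<lambda>y. 1) else deriv (R (r powr (1 / real k))))"

lemma relu_act_0: "relu_act 0 = (\<lambda>y. y)"
  by (simp add: relu_act_def)

lemma reg_act_0: "reg_act R r 0 = (\<lambda>y. y)"
  by (simp add: reg_act_def)

lemma NN_inf_eq: "NN_inf l \<theta> k x = realization l relu_act \<theta> k x"
  unfolding NN_inf_def by (rule realization_cong_act) (simp add: relu_act_def)

lemma NN_r_eq: "NN_r l R r \<theta> k x = realization l (reg_act R r) \<theta> k x"
  unfolding NN_r_def by (rule realization_cong_act) (simp add: reg_act_def)

lemma admissible_relu: "1 \<le> C \<Longrightarrow> admissible C relu_act relu_act'"
  by (auto simp: admissible_def relu_act_def relu_act'_def)

text \<open>Euler's identity: scaling the biases of layer \<open>h\<close> by \<open>s ^ h\<close> and all weights by \<open>s\<close> scales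
  the output of layer \<open>h\<close> by \<open>s ^ h\<close>. The direction \<open>\<eta>\<close> is the gradient of the Lyapunov function.\<close>

lemma tangent_relu_homogeneous:
  assumes b: "\<And>k i. k < n \<Longrightarrow> i \<in> {1..l (Suc k)} \<Longrightarrow> \<eta> (bidx l k i) = 2 * real (Suc k) * \<theta> (bidx l k i) - 2 * c k i"
    and w: "\<And>k i j. k < n \<Longrightarrow> i \<in> {1..l (Suc k)} \<Longrightarrow> j \<in> {1..l k} \<Longrightarrow> \<eta> (widx l k i j) = 2 * \<theta> (widx l k i j)"
    and c: "\<And>k i. Suc k < n \<Longrightarrow> i \<in> {1..l (Suc k)} \<Longrightarrow> c k i = 0"
    and k: "k < n" and i: "i \<in> {1..l (Suc k)}"
  shows "tangent l relu_act relu_act' \<theta> \<eta> (Suc k) x i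
    = 2 * (real (Suc k) * realization l relu_act \<theta> (Suc k) x i - c k i)"
  using k i
proof (induction k arbitrary: i)
  case 0
  show ?case
    using b[OF 0] w[OF 0]
    unfolding realization_Suc[where l = l and act = relu_act, OF relu_act_0 0(2)]
    by (simp add: algebra_simps sum_distrib_left)
next
  case (Suc k)
  \<comment> \<open>The shift \<open>c\<close> vanishes below the last layer, so it never has to
    pass through an activation.\<close>
  have IH: "tangent l relu_act relu_act' \<theta> \<eta> (Suc k) x j
      = 2 * (real (Suc k) * realization l relu_act \<theta> (Suc k) x j)" if "j \<in> {1..l (Suc k)}" for j
    using Suc.IH[OF _ that] c[OF Suc.prems(1) that] Suc.prems(1) by simp
  have step: "\<eta> (widx l (Suc k) i j) * relu_act (Suc k) (realization l relu_act \<theta> (Suc k) x j) +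
        \<theta> (widx l (Suc k) i j) * (relu_act' (Suc k) (realization l relu_act \<theta> (Suc k) x j) *
          tangent l relu_act relu_act' \<theta> \<eta> (Suc k) x j)
      = 2 * real (Suc (Suc k)) * (\<theta> (widx l (Suc k) i j) * relu_act (Suc k) (realization l relu_act \<theta> (Suc k) x j))"
    if "j \<in> {1..l (Suc k)}" for j
    \<comment> \<open>The derivative of ReLU times its argument is ReLU itself, also at 0. The
      factors 2 from the weight direction and 2 (k + 1) from the layer below add up to 2 (k +
      2).\<close>
    unfolding IH[OF that] w[OF Suc.prems that] by (auto simp: relu_act_def relu_act'_def algebra_simps)
  have "tangent l relu_act relu_act' \<theta> \<eta> (Suc (Suc k)) x i = 2 * real (Suc (Suc k)) * \<theta> (bidx l (Suc k) i) - 2 * c (Suc k) i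
      + (\<Sum>j=1..l (Suc k). 2 * real (Suc (Suc k)) *
          (\<theta> (widx l (Suc k) i j) * relu_act (Suc k) (realization l relu_act \<theta> (Suc k) x j)))"
    unfolding tangent.simps(2)[of l relu_act relu_act' \<theta> \<eta> "Suc k"] b[OF Suc.prems]
    by (intro arg_cong2[where f = "(+)"] refl sum.cong step)
  also have "(\<Sum>j=1..l (Suc k). 2 * real (Suc (Suc k)) *
          (\<theta> (widx l (Suc k) i j) * relu_act (Suc k) (realization l relu_act \<theta> (Suc k) x j)))
      = 2 * real (Suc (Suc k)) *
          (\<Sum>j=1..l (Suc k). \<theta> (widx l (Suc k) i j) * relu_act (Suc k) (realization l relu_act \<theta> (Suc k) x j))"
    by (rule sum_distrib_left[symmetric])
  finally show ?case
    unfolding realization_Suc[where l = l and act = relu_act, OF relu_act_0 Suc.prems(2)]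
    by (simp only: right_diff_distrib distrib_left mult.assoc add_diff_eq diff_add_eq)
qed

text \<open>Requiring \<open>C\<close> to be at least 1 lets the same bound cover the identity at
  index 0 and the ReLU derivative.\<close>

locale relu_approximation =
  fixes R :: "real \<Rightarrow> real \<Rightarrow> real" and A B C :: real
  assumes A_pos: "0 < A"
    and C1: "\<And>r. r \<ge> 1 \<Longrightarrow> R r C1_differentiable_on UNIV"
    and zero: "\<And>r x. r \<ge> 1 \<Longrightarrow> x \<le> A / r \<Longrightarrow> R r x = 0"
    and bounds: "\<And>r y. r \<ge> 1 \<Longrightarrow> 0 \<le> R r y \<and> R r y \<le> max y 0"
    and identity: "\<And>r z. r \<ge> 1 \<Longrightarrow> z \<ge> B / r \<Longrightarrow> R r z = z"
    and deriv_bound: "\<And>r x. r \<ge> 1 \<Longrightarrow> \<bar>deriv (R r) x\<bar> \<le> C"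
    and B_pos: "0 < B" and C_ge_1: "1 \<le> C"
begin

lemma rate_ge_1: "r \<ge> 1 \<Longrightarrow> r powr (1 / real k) \<ge> 1"
  by (rule ge_one_powr_ge_zero) auto

lemma has_deriv: "r \<ge> 1 \<Longrightarrow> (R r has_real_derivative deriv (R r) y) (at y)"
  and continuous_deriv: "r \<ge> 1 \<Longrightarrow> continuous_on UNIV (deriv (R r))"
proof -
  assume r: "r \<ge> 1"
  obtain D where D: "\<And>x. (R r has_vector_derivative D x) (at x)" "continuous_on UNIV D"
    using C1[OF r] unfolding C1_differentiable_on_def by auto
  have D': "(R r has_real_derivative D x) (at x)" for x
    using D(1) by (simp add: has_real_derivative_iff_has_vector_derivative)
  have "deriv (R r) = D" by (rule ext) (rule DERIV_imp_deriv[OF D'])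
  with D(2) D' show "(R r has_real_derivative deriv (R r) y) (at y)" "continuous_on UNIV (deriv (R r))"
    by auto
qed

lemma deriv_eq_0: "r \<ge> 1 \<Longrightarrow> y < A / r \<Longrightarrow> deriv (R r) y = 0"
  by (rule DERIV_imp_deriv, rule has_field_derivative_transform_within_open[of "\<lambda>_. 0" _ _ "{..<A / r}"])
     (auto simp: zero)

lemma deriv_eq_1: "r \<ge> 1 \<Longrightarrow> y > B / r \<Longrightarrow> deriv (R r) y = 1"
  by (rule DERIV_imp_deriv, rule has_field_derivative_transform_within_open[of "\<lambda>y. y" _ _ "{B / r<..}"])
     (auto simp: identity)

text \<open>Above \<open>B / r\<close> the two functions agree; below it both lie between 0 and
  \<open>B / r\<close>.\<close>

lemma approx_error:
  assumes "r \<ge> 1" shows "\<bar>R r y - max y 0\<bar> \<le> B / r"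
proof (cases "y \<ge> B / r")
  case True
  then have "0 \<le> y" using assms B_pos by (smt (verit) divide_nonneg_nonneg)
  with True show ?thesis using identity[OF assms True] assms B_pos by simp
next
  case False
  have "0 \<le> B / r" using assms B_pos by simp
  with False show ?thesis using bounds[OF assms, of y] by auto
qed

lemma error_tendsto_0:
  assumes "k \<noteq> 0" shows "((\<lambda>r::real. B / r powr (1 / real k)) \<longlongrightarrow> 0) at_top"
proof -
  have "((\<lambda>r::real. r powr (- (1 / real k))) \<longlongrightarrow> 0) at_top"
    by (rule tendsto_neg_powr[OF _ filterlim_ident]) (use assms in simp)
  then have "((\<lambda>r::real. B * r powr (- (1 / real k))) \<longlongrightarrow> 0) at_top"
    by (rule tendsto_mult_right_zero)
  then show ?thesis by (simp add: powr_minus divide_inverse)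
qed

lemma reg_act_has_derivative:
  "r \<ge> 1 \<Longrightarrow> (reg_act R r k has_real_derivative reg_act' R r k y) (at y)"
  by (auto simp: reg_act_def reg_act'_def intro!: has_deriv rate_ge_1)

lemma continuous_reg_act': "r \<ge> 1 \<Longrightarrow> continuous_on UNIV (reg_act' R r k)"
  using rate_ge_1 by (auto simp: reg_act'_def intro!: continuous_deriv)

lemma continuous_reg_act: "r \<ge> 1 \<Longrightarrow> continuous_on UNIV (reg_act R r k)"
  using DERIV_isCont[OF reg_act_has_derivative] by (simp add: continuous_at_imp_continuous_on)

lemma admissible_reg:
  assumes r: "r \<ge> 1" shows "admissible C (reg_act R r) (reg_act' R r)"
  unfolding admissible_def
proof (intro conjI allI)
  show "\<bar>reg_act R r k y\<bar> \<le> \<bar>y\<bar>" for k y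
    using bounds[OF rate_ge_1[OF r], of k y] by (auto simp: reg_act_def)
  show "\<bar>reg_act' R r k y\<bar> \<le> C" for k y
    using deriv_bound[OF rate_ge_1[OF r], of k y] C_ge_1 by (auto simp: reg_act'_def)
qed (auto simp: reg_act_0 intro!: borel_measurable_continuous_onI continuous_reg_act continuous_reg_act' r)

text \<open>The error produced by layer \<open>k\<close> is of order \<open>r powr (-1/k)\<close>, so it is negligible on the
  scale \<open>r powr (-1/(k+1))\<close> on which the next activation differs from the ReLU function.\<close>

lemma realization_rate:
  assumes "i \<in> {1..l (Suc k)}"
  shows "((\<lambda>r. r powr (1 / real (Suc k)) * (realization l (reg_act R r) \<theta> (Suc k) x i
      - realization l relu_act \<theta> (Suc k) x i)) \<longlongrightarrow> 0) at_top"
  using assms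
proof (induction k arbitrary: i)
  case 0
  \<comment> \<open>No activation precedes the first affine layer, so the error there is exactly
    zero.\<close>
  have "realization l (reg_act R r) \<theta> (Suc 0) x i = realization l relu_act \<theta> (Suc 0) x i" for r
    by simp
  then show ?case by simp
next
  case (Suc k)
  let ?N = "\<lambda>r j. realization l (reg_act R r) \<theta> (Suc k) x j"
  let ?Nlim = "\<lambda>j. realization l relu_act \<theta> (Suc k) x j"
  have eq: "realization l (reg_act R r) \<theta> (Suc (Suc k)) x i - realization l relu_act \<theta> (Suc (Suc k)) x i
      = (\<Sum>j=1..l (Suc k). \<theta> (widx l (Suc k) i j) *
          (reg_act R r (Suc k) (?N r j) - relu_act (Suc k) (?Nlim j)))" for r
    unfolding realization_Suc[where l = l and act = "reg_act R r", OF reg_act_0 Suc.prems]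
      realization_Suc[where l = l and act = relu_act, OF relu_act_0 Suc.prems]
    by (simp add: sum_subtractf right_diff_distrib)
  have "((\<lambda>r. r powr (1 / real (Suc (Suc k))) * (reg_act R r (Suc k) (?N r j) - relu_act (Suc k) (?Nlim j)))
      \<longlongrightarrow> 0) at_top" if j: "j \<in> {1..l (Suc k)}" for j
  proof (rule Lim_null_comparison)
    \<comment> \<open>The new error has two sources. The activation error, of order r^(-1/(k+1)), is
      beaten by the weight r^(1/(k+2)) because the exponents add up to a negative number; the
      inherited error tends to 0 even with the larger weight r^(1/(k+1)).\<close>
    have "1 / real (Suc (Suc k)) - 1 / real (Suc k) < 0"
      using divide_strict_left_mono[of "real (Suc k)" "real (Suc (Suc k))" 1] by simp
    then have "((\<lambda>r::real. r powr (1 / real (Suc (Suc k)) - 1 / real (Suc k))) \<longlongrightarrow> 0) at_top"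
      by (rule tendsto_neg_powr[OF _ filterlim_ident])
    then show "((\<lambda>r. B * r powr (1 / real (Suc (Suc k)) - 1 / real (Suc k))
        + \<bar>r powr (1 / real (Suc k)) * (?N r j - ?Nlim j)\<bar>) \<longlongrightarrow> 0) at_top"
      by (intro tendsto_add_zero tendsto_mult_right_zero tendsto_rabs_zero Suc.IH j)
    show "\<forall>\<^sub>F r in at_top. norm (r powr (1 / real (Suc (Suc k))) *
          (reg_act R r (Suc k) (?N r j) - relu_act (Suc k) (?Nlim j)))
        \<le> B * r powr (1 / real (Suc (Suc k)) - 1 / real (Suc k))
          + \<bar>r powr (1 / real (Suc k)) * (?N r j - ?Nlim j)\<bar>"
      using eventually_ge_at_top[of 1]
    proof eventually_elim
      case (elim r)
      have "\<bar>reg_act R r (Suc k) (?N r j) - max (?N r j) 0\<bar> \<le> B / r powr (1 / real (Suc k))"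
        using approx_error[OF rate_ge_1[OF elim, of "Suc k"]] by (simp add: reg_act_def)
      moreover have "\<bar>max (?N r j) 0 - relu_act (Suc k) (?Nlim j)\<bar> \<le> \<bar>?N r j - ?Nlim j\<bar>"
        by (auto simp: relu_act_def)
      ultimately have "\<bar>reg_act R r (Suc k) (?N r j) - relu_act (Suc k) (?Nlim j)\<bar>
          \<le> B / r powr (1 / real (Suc k)) + \<bar>?N r j - ?Nlim j\<bar>" by linarith
      then have "r powr (1 / real (Suc (Suc k))) * \<bar>reg_act R r (Suc k) (?N r j) - relu_act (Suc k) (?Nlim j)\<bar>
          \<le> r powr (1 / real (Suc (Suc k))) * (B / r powr (1 / real (Suc k)))
            + r powr (1 / real (Suc (Suc k))) * \<bar>?N r j - ?Nlim j\<bar>"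
        by (metis distrib_left mult_left_mono powr_ge_zero)
      moreover have "r powr (1 / real (Suc (Suc k))) * \<bar>?N r j - ?Nlim j\<bar>
          \<le> r powr (1 / real (Suc k)) * \<bar>?N r j - ?Nlim j\<bar>"
        using elim by (intro mult_right_mono powr_mono) (auto simp: field_simps)
      ultimately show ?case by (simp add: abs_mult powr_diff mult_ac)
    qed
  qed
  then have "((\<lambda>r. \<Sum>j=1..l (Suc k). \<theta> (widx l (Suc k) i j) * (r powr (1 / real (Suc (Suc k))) *
      (reg_act R r (Suc k) (?N r j) - relu_act (Suc k) (?Nlim j)))) \<longlongrightarrow> 0) at_top"
    by (intro tendsto_null_sum tendsto_mult_right_zero)
  then show ?case unfolding eq by (simp add: sum_distrib_left mult_ac)
qed

lemma reg_act_tendsto: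
  assumes "((\<lambda>r. realization l (reg_act R r) \<theta> k x j) \<longlongrightarrow> realization l relu_act \<theta> k x j) at_top"
  shows "((\<lambda>r. reg_act R r k (realization l (reg_act R r) \<theta> k x j))
    \<longlongrightarrow> relu_act k (realization l relu_act \<theta> k x j)) at_top"
proof (cases "k = 0")
  case False
  let ?N = "\<lambda>r. realization l (reg_act R r) \<theta> k x j"
  have "((\<lambda>r. reg_act R r k (?N r) - max (?N r) 0) \<longlongrightarrow> 0) at_top"
  proof (rule Lim_null_comparison)
    show "((\<lambda>r::real. B / r powr (1 / real k)) \<longlongrightarrow> 0) at_top"
      by (rule error_tendsto_0[OF False])
    show "\<forall>\<^sub>F r in at_top. norm (reg_act R r k (?N r) - max (?N r) 0) \<le> B / r powr (1 / real k)"
      using eventually_ge_at_top[of 1]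
      by eventually_elim (use False approx_error[OF rate_ge_1] in \<open>simp add: reg_act_def\<close>)
  qed
  from tendsto_add[OF this tendsto_max[OF assms tendsto_const[of 0]]]
  show ?thesis using False by (simp add: relu_act_def)
qed (use assms in \<open>simp add: reg_act_def relu_act_def\<close>)

text \<open>The derivatives are not merely convergent but eventually equal to the limit. For a
  nonzero limiting input, convergence of the inputs puts them into a region where the regularized
  activation is the identity or zero; for limiting input 0 this needs
  \<open>realization_rate\<close>.\<close>

lemma reg_act'_tendsto:
  assumes j: "j \<in> {1..l k}"
    and lim: "((\<lambda>r. realization l (reg_act R r) \<theta> k x j) \<longlongrightarrow> realization l relu_act \<theta> k x j) at_top"
  shows "((\<lambda>r. reg_act' R r k (realization l (reg_act R r) \<theta> k x j))
    \<longlongrightarrow> relu_act' k (realization l relu_act \<theta> k x j)) at_top"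
proof (cases k)
  case (Suc k')
  let ?N = "\<lambda>r. realization l (reg_act R r) \<theta> k x j"
  let ?Nlim = "realization l relu_act \<theta> k x j"
  let ?s = "\<lambda>r. r powr (1 / real k)"
  have k: "k \<noteq> 0" using Suc by simp
  have ev: "\<forall>\<^sub>F r in at_top. r \<ge> (1::real)" by (rule eventually_ge_at_top)
  have rate: "((\<lambda>r. ?s r * (?N r - ?Nlim)) \<longlongrightarrow> 0) at_top"
    using realization_rate[of j l k' \<theta> x] j unfolding Suc by simp
  have "\<forall>\<^sub>F r in at_top. deriv (R (?s r)) (?N r) = (if ?Nlim > 0 then 1 else 0)"
  proof -
    consider "?Nlim > 0" | "?Nlim < 0" | "?Nlim = 0" by linarith
    then show ?thesis
    proof cases
      case 1
      have "\<forall>\<^sub>F r in at_top. ?N r > ?Nlim / 2" using lim 1 by (intro order_tendstoD(1)) auto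
      moreover have "\<forall>\<^sub>F r in at_top. B / ?s r < ?Nlim / 2"
        using error_tendsto_0[OF k] 1 by (intro order_tendstoD(2)) auto
      ultimately show ?thesis using ev
      proof eventually_elim
        case (elim r)
        have s: "?s r \<ge> 1" by (rule rate_ge_1[OF elim(3)])
        show ?case using deriv_eq_1[OF s, of "?N r"] elim(1,2) 1 by simp
      qed
    next
      case 2
      have "\<forall>\<^sub>F r in at_top. ?N r < 0" using lim 2 by (intro order_tendstoD(2)) auto
      then show ?thesis using ev
      proof eventually_elim
        case (elim r)
        have s: "?s r \<ge> 1" by (rule rate_ge_1[OF elim(2)])
        have "0 < A / ?s r" using A_pos s by (intro divide_pos_pos) linarith+
        then show ?case using deriv_eq_0[OF s, of "?N r"] elim(1) 2 by simp
      qed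
    next
      case 3
      \<comment> \<open>The positivity of \<open>A\<close> leaves room to the right of 0: the
        rescaled input tends to 0 and eventually stays below \<open>A\<close>, whatever its
        sign.\<close>
      have "\<forall>\<^sub>F r in at_top. ?s r * (?N r - ?Nlim) < A"
        using rate A_pos by (intro order_tendstoD(2)) auto
      then show ?thesis using ev
      proof eventually_elim
        case (elim r)
        have s: "?s r \<ge> 1" by (rule rate_ge_1[OF elim(2)])
        have "0 < ?s r" using s by linarith
        then have "?N r < A / ?s r" using elim(1) 3 by (simp add: pos_less_divide_eq mult.commute)
        then show ?case using deriv_eq_0[OF s, of "?N r"] 3 by simp
      qed
    qed
  qed
  then have "\<forall>\<^sub>F r in at_top. reg_act' R r k (?N r) = relu_act' k ?Nlim"
    using k by (simp add: reg_act'_def relu_act'_def)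
  then show ?thesis by (rule tendsto_eventually)
qed (simp add: reg_act'_def relu_act'_def)

lemma realization_tangent_reg_tendsto:
  assumes i: "i \<in> {1..l k}"
  shows "((\<lambda>r. realization l (reg_act R r) \<theta> k x i) \<longlongrightarrow> realization l relu_act \<theta> k x i) at_top"
    and "((\<lambda>r. tangent l (reg_act R r) (reg_act' R r) \<theta> \<eta> k x i)
      \<longlongrightarrow> tangent l relu_act relu_act' \<theta> \<eta> k x i) at_top"
  by (rule realization_tangent_tendsto[where act = "reg_act R" and act' = "reg_act' R" and \<theta> = "\<lambda>_. \<theta>"
        and act\<^sub>0 = relu_act and act'\<^sub>0 = relu_act' and \<theta>\<^sub>0 = \<theta> and N = k];
      simp add: reg_act_0 relu_act_0 reg_act_tendsto reg_act'_tendsto i[simplified])+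

end

section \<open>The loss and its generalized gradient\<close>

abbreviation unit_vec :: "nat \<Rightarrow> nat \<Rightarrow> real" where
  "unit_vec m \<equiv> (\<lambda>p. if p = m then 1 else 0)"

text \<open>The target is a constant vector \<open>y\<close>, as the target function is constant on
  the cube. Bounded inputs and a finite measure make every dominating function a constant.\<close>

locale loss_setting = finite_measure \<mu> for \<mu> :: "(nat \<Rightarrow> real) measure" +
  fixes l :: "nat \<Rightarrow> nat" and L :: nat and y :: "nat \<Rightarrow> real" and X :: real
  assumes coord_measurable: "\<And>j. j \<in> {1..l 0} \<Longrightarrow> (\<lambda>x. x j) \<in> borel_measurable \<mu>"
    and coord_bound: "\<And>x j. x \<in> space \<mu> \<Longrightarrow> j \<in> {1..l 0} \<Longrightarrow> \<bar>x j\<bar> \<le> X"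
    and X_nonneg: "0 \<le> X"
begin

definition err :: "(nat \<Rightarrow> real \<Rightarrow> real) \<Rightarrow> (nat \<Rightarrow> real) \<Rightarrow> (nat \<Rightarrow> real) \<Rightarrow> real" where
  "err act \<theta> x = (\<Sum>i=1..l L. (realization l act \<theta> L x i - y i)\<^sup>2)"

definition derr :: "(nat \<Rightarrow> real \<Rightarrow> real) \<Rightarrow> (nat \<Rightarrow> real \<Rightarrow> real) \<Rightarrow> (nat \<Rightarrow> real) \<Rightarrow> (nat \<Rightarrow> real)
    \<Rightarrow> (nat \<Rightarrow> real) \<Rightarrow> real" where
  "derr act act' \<theta> \<eta> x =
     (\<Sum>i=1..l L. 2 * (realization l act \<theta> L x i - y i) * tangent l act act' \<theta> \<eta> L x i)"

definition loss :: "(nat \<Rightarrow> real \<Rightarrow> real) \<Rightarrow> (nat \<Rightarrow> real) \<Rightarrow> real" where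
  "loss act \<theta> = (\<integral>x. err act \<theta> x \<partial>\<mu>)"

definition dloss :: "(nat \<Rightarrow> real \<Rightarrow> real) \<Rightarrow> (nat \<Rightarrow> real \<Rightarrow> real) \<Rightarrow> (nat \<Rightarrow> real) \<Rightarrow> (nat \<Rightarrow> real) \<Rightarrow> real" where
  "dloss act act' \<theta> \<eta> = (\<integral>x. derr act act' \<theta> \<eta> x \<partial>\<mu>)"

definition err_bound :: "real \<Rightarrow> real" where
  "err_bound K = (\<Sum>i=1..l L. (realization_bound l K X L + \<bar>y i\<bar>)\<^sup>2)"

definition derr_bound :: "real \<Rightarrow> real \<Rightarrow> real" where
  "derr_bound C K = (\<Sum>i=1..l L. 2 * (realization_bound l K X L + \<bar>y i\<bar>) * tangent_bound l K X C L)"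

text \<open>The bounds depend on the activations only through \<open>C\<close>, hence hold
  simultaneously for all regularizations and for the ReLU limit.\<close>

lemma abs_err_le:
  assumes adm: "admissible C act act'" and K: "0 \<le> K"
    and \<theta>: "\<And>m. m \<in> {1..dsum l L} \<Longrightarrow> \<bar>\<theta> m\<bar> \<le> K" and x: "x \<in> space \<mu>"
  shows "\<bar>err act \<theta> x\<bar> \<le> err_bound K"
    and "m \<in> {1..dsum l L} \<Longrightarrow> \<bar>derr act act' \<theta> (unit_vec m) x\<bar> \<le> derr_bound C K"
proof -
  have act: "act 0 = (\<lambda>y. y)" "\<And>k y. \<bar>act k y\<bar> \<le> \<bar>y\<bar>" "\<And>k y. \<bar>act' k y\<bar> \<le> C"
    using adm by (auto simp: admissible_def)
  have N: "\<bar>realization l act \<theta> L x i - y i\<bar> \<le> realization_bound l K X L + \<bar>y i\<bar>" if "i \<in> {1..l L}" for i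
    using abs_realization_le[where l = l and n = L and X = X and act = act and \<theta> = \<theta> and x = x and K = K and k = L and i = i,
        OF act(1,2) \<theta> coord_bound[OF x] K X_nonneg order_refl that] by linarith
  have "err act \<theta> x \<le> err_bound K"
    unfolding err_def err_bound_def by (rule sum_mono) (use power_mono[OF N, of _ 2] in auto)
  moreover have "0 \<le> err act \<theta> x" unfolding err_def by (intro sum_nonneg) auto
  ultimately show "\<bar>err act \<theta> x\<bar> \<le> err_bound K" by simp
  assume m: "m \<in> {1..dsum l L}"
  have T: "\<bar>tangent l act act' \<theta> (unit_vec m) L x i\<bar> \<le> tangent_bound l K X C L" if "i \<in> {1..l L}" for i
    by (rule abs_tangent_le[where n = L]) (use act \<theta> coord_bound[OF x] K X_nonneg that in auto)
  show "\<bar>derr act act' \<theta> (unit_vec m) x\<bar> \<le> derr_bound C K"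
    unfolding derr_def derr_bound_def
  proof (rule order_trans[OF sum_abs sum_mono])
    fix i assume i: "i \<in> {1..l L}"
    have "\<bar>realization l act \<theta> L x i - y i\<bar> * \<bar>tangent l act act' \<theta> (unit_vec m) L x i\<bar>
        \<le> (realization_bound l K X L + \<bar>y i\<bar>) * tangent_bound l K X C L"
      by (rule mult_mono[OF N[OF i] T[OF i]]) (simp_all add: realization_bound_nonneg K X_nonneg)
    then show "\<bar>2 * (realization l act \<theta> L x i - y i) * tangent l act act' \<theta> (unit_vec m) L x i\<bar>
        \<le> 2 * (realization_bound l K X L + \<bar>y i\<bar>) * tangent_bound l K X C L"
      unfolding abs_mult abs_numeral mult.assoc by (rule mult_left_mono) simp
  qed
qed

lemma err_measurable:
  assumes adm: "admissible C act act'"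
  shows "err act \<theta> \<in> borel_measurable \<mu>" and "derr act act' \<theta> \<eta> \<in> borel_measurable \<mu>"
proof -
  have act: "act 0 = (\<lambda>y. y)" "\<And>k. act k \<in> borel_measurable borel" "\<And>k. act' k \<in> borel_measurable borel"
    using adm by (auto simp: admissible_def)
  note meas = realization_tangent_measurable[where act = act and act' = act' and l = l, OF act coord_measurable]
  show "err act \<theta> \<in> borel_measurable \<mu>" unfolding err_def[abs_def]
    by (intro borel_measurable_sum borel_measurable_power borel_measurable_diff borel_measurable_const meas)
  show "derr act act' \<theta> \<eta> \<in> borel_measurable \<mu>" unfolding derr_def[abs_def]
    by (intro borel_measurable_sum borel_measurable_times borel_measurable_diff borel_measurable_const meas)
qed

lemma params_bounded:
  fixes \<theta> :: "nat \<Rightarrow> real"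
  shows "\<exists>K\<ge>0. \<forall>m\<in>{1..dsum l L}. \<bar>\<theta> m\<bar> \<le> K"
proof (intro exI[of _ "\<Sum>m=1..dsum l L. \<bar>\<theta> m\<bar>"] conjI ballI)
  show "\<bar>\<theta> m\<bar> \<le> (\<Sum>m=1..dsum l L. \<bar>\<theta> m\<bar>)" if "m \<in> {1..dsum l L}" for m
    by (rule member_le_sum[OF that, of "\<lambda>m. \<bar>\<theta> m\<bar>"]) auto
qed (auto intro: sum_nonneg)

lemma err_integrable:
  assumes adm: "admissible C act act'"
  shows "integrable \<mu> (err act \<theta>)"
    and "m \<in> {1..dsum l L} \<Longrightarrow> integrable \<mu> (derr act act' \<theta> (unit_vec m))"
proof -
  obtain K where K: "0 \<le> K" "\<And>m. m \<in> {1..dsum l L} \<Longrightarrow> \<bar>\<theta> m\<bar> \<le> K" using params_bounded by blast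
  show "integrable \<mu> (err act \<theta>)"
    by (rule integrable_const_bound[where B = "err_bound K"])
       (use abs_err_le(1)[OF adm K] err_measurable[OF adm] in auto)
  show "integrable \<mu> (derr act act' \<theta> (unit_vec m))" if "m \<in> {1..dsum l L}"
    by (rule integrable_const_bound[where B = "derr_bound C K"])
       (use abs_err_le(2)[OF adm K _ that] err_measurable[OF adm] in auto)
qed

lemma derr_linear:
  "derr act act' \<theta> \<eta> x = (\<Sum>m=1..dsum l L. \<eta> m * derr act act' \<theta> (unit_vec m) x)"
proof -
  have "derr act act' \<theta> \<eta> x = (\<Sum>i=1..l L. 2 * (realization l act \<theta> L x i - y i) *
      (\<Sum>m=1..dsum l L. \<eta> m * tangent l act act' \<theta> (unit_vec m) L x i))"
    unfolding derr_def by (intro sum.cong refl arg_cong2[where f = "(*)"] tangent_linear) auto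
  also have "\<dots> = (\<Sum>m=1..dsum l L. \<eta> m * derr act act' \<theta> (unit_vec m) x)"
    unfolding derr_def sum_distrib_left by (subst sum.swap) (simp add: mult_ac)
  finally show ?thesis .
qed

lemma dloss_linear:
  assumes adm: "admissible C act act'"
  shows "dloss act act' \<theta> \<eta> = (\<Sum>m=1..dsum l L. dloss act act' \<theta> (unit_vec m) * \<eta> m)"
  unfolding dloss_def derr_linear[of act act' \<theta> \<eta>]
  using err_integrable(2)[OF adm] by (simp add: mult.commute)

lemma abs_dloss_le:
  assumes adm: "admissible C act act'" and K: "0 \<le> K"
    and \<theta>: "\<And>m. m \<in> {1..dsum l L} \<Longrightarrow> \<bar>\<theta> m\<bar> \<le> K" and m: "m \<in> {1..dsum l L}"
  shows "\<bar>dloss act act' \<theta> (unit_vec m)\<bar> \<le> derr_bound C K * measure \<mu> (space \<mu>)"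
proof -
  have "\<bar>dloss act act' \<theta> (unit_vec m)\<bar> \<le> (\<integral>x. \<bar>derr act act' \<theta> (unit_vec m) x\<bar> \<partial>\<mu>)"
    unfolding dloss_def by (rule integral_abs_bound)
  also have "\<dots> \<le> (\<integral>x. derr_bound C K \<partial>\<mu>)"
    by (rule integral_mono) (use err_integrable(2)[OF adm m] abs_err_le(2)[OF adm K \<theta> _ m] in auto)
  finally show ?thesis by (simp add: mult.commute)
qed

lemma loss_has_derivative:
  assumes adm: "admissible C act act'"
    and deriv: "\<And>k y. (act k has_real_derivative act' k y) (at y)"
  shows "((\<lambda>h. loss act (\<lambda>m. \<theta> m + h * \<eta> m)) has_real_derivative
    (\<Sum>m=1..dsum l L. dloss act act' (\<lambda>m. \<theta> m + h * \<eta> m) (unit_vec m) * \<eta> m)) (at h)"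
proof -
  let ?p = "\<lambda>h m. \<theta> m + h * \<eta> m"
  \<comment> \<open>This bounds all parameters reached with a step size within distance 1 of
    \<open>h\<close>, the range for which differentiation under the integral asks for
    domination.\<close>
  obtain K where K: "0 \<le> K" "\<And>m. m \<in> {1..dsum l L} \<Longrightarrow> \<bar>\<bar>\<theta> m\<bar> + (\<bar>h\<bar> + 1) * \<bar>\<eta> m\<bar>\<bar> \<le> K"
    using params_bounded[of "\<lambda>m. \<bar>\<theta> m\<bar> + (\<bar>h\<bar> + 1) * \<bar>\<eta> m\<bar>"] by blast
  have p: "\<bar>?p h' m\<bar> \<le> K" if m: "m \<in> {1..dsum l L}" and h': "\<bar>h' - h\<bar> \<le> 1" for h' m
  proof -
    have "\<bar>h' * \<eta> m\<bar> \<le> (\<bar>h\<bar> + 1) * \<bar>\<eta> m\<bar>"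
      unfolding abs_mult by (rule mult_right_mono) (use h' in auto)
    then show ?thesis using K(2)[OF m] by linarith
  qed
  have "((\<lambda>h. \<integral>x. err act (?p h) x \<partial>\<mu>) has_real_derivative (\<integral>x. derr act act' (?p h) \<eta> x \<partial>\<mu>)) (at h)"
  proof (rule integral_has_derivative_under[where K = "\<Sum>m=1..dsum l L. \<bar>\<eta> m\<bar> * derr_bound C K"])
    show "((\<lambda>h. err act (?p h) x) has_real_derivative derr act act' (?p h) \<eta> x) (at h)" for h x
    proof -
      have act0: "act 0 = (\<lambda>y. y)" using adm by (simp add: admissible_def)
      have *: "((\<lambda>h. realization l act (\<lambda>m. \<theta> m + h * \<eta> m) L x i) has_real_derivative
          tangent l act act' (\<lambda>m. \<theta> m + h * \<eta> m) \<eta> L x i) (at h)" if "i \<in> {1..l L}" for i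
        by (rule realization_has_derivative) (use act0 deriv that in auto)
      show ?thesis unfolding err_def derr_def
        by (auto intro!: derivative_eq_intros * sum.cong)
    qed
    show "\<bar>derr act act' (?p h') \<eta> x\<bar> \<le> (\<Sum>m=1..dsum l L. \<bar>\<eta> m\<bar> * derr_bound C K)"
      if x: "x \<in> space \<mu>" and h': "\<bar>h' - h\<bar> \<le> 1" for h' x
      unfolding derr_linear[of act act' "?p h'" \<eta> x]
    proof (rule order_trans[OF sum_abs sum_mono])
      fix m assume m: "m \<in> {1..dsum l L}"
      show "\<bar>\<eta> m * derr act act' (?p h') (unit_vec m) x\<bar> \<le> \<bar>\<eta> m\<bar> * derr_bound C K"
        unfolding abs_mult
        by (rule mult_left_mono[OF abs_err_le(2)[OF adm K(1) p[OF _ h'] x m]]) auto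
    qed
  qed (use err_integrable(1)[OF adm] err_measurable(2)[OF adm] finite_measure_axioms in auto)
  then show ?thesis
    unfolding loss_def[symmetric] dloss_def[symmetric] dloss_linear[OF adm, of _ \<eta>] .
qed

text \<open>Activations and parameters may vary at once, so this one dominated convergence argument
  yields both the limit of vanishing regularization and the continuity of the regularized
  gradients.\<close>

lemma loss_dloss_tendsto:
  fixes act act' :: "nat \<Rightarrow> nat \<Rightarrow> real \<Rightarrow> real"
  assumes adm: "\<And>n. admissible C (act n) (act' n)" and adm0: "admissible C act\<^sub>0 act'\<^sub>0"
    and K: "0 \<le> K" and \<theta>: "\<And>n m. m \<in> {1..dsum l L} \<Longrightarrow> \<bar>\<theta> n m\<bar> \<le> K"
    and real: "\<And>x i. x \<in> space \<mu> \<Longrightarrow> i \<in> {1..l L} \<Longrightarrow>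
      (\<lambda>n. realization l (act n) (\<theta> n) L x i) \<longlonglongrightarrow> realization l act\<^sub>0 \<theta>\<^sub>0 L x i"
    and tang: "\<And>x i \<eta>. x \<in> space \<mu> \<Longrightarrow> i \<in> {1..l L} \<Longrightarrow>
      (\<lambda>n. tangent l (act n) (act' n) (\<theta> n) \<eta> L x i) \<longlonglongrightarrow> tangent l act\<^sub>0 act'\<^sub>0 \<theta>\<^sub>0 \<eta> L x i"
  shows "(\<lambda>n. loss (act n) (\<theta> n)) \<longlonglongrightarrow> loss act\<^sub>0 \<theta>\<^sub>0"
    and "m \<in> {1..dsum l L} \<Longrightarrow> (\<lambda>n. dloss (act n) (act' n) (\<theta> n) (unit_vec m)) \<longlonglongrightarrow> dloss act\<^sub>0 act'\<^sub>0 \<theta>\<^sub>0 (unit_vec m)"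
proof -
  show "(\<lambda>n. loss (act n) (\<theta> n)) \<longlonglongrightarrow> loss act\<^sub>0 \<theta>\<^sub>0"
    unfolding loss_def
  proof (rule integral_dominated_convergence[where w = "\<lambda>_. err_bound K"])
    show "AE x in \<mu>. (\<lambda>n. err (act n) (\<theta> n) x) \<longlonglongrightarrow> err act\<^sub>0 \<theta>\<^sub>0 x"
      unfolding err_def by (intro AE_I2 tendsto_intros real)
    show "AE x in \<mu>. norm (err (act n) (\<theta> n) x) \<le> err_bound K" for n
      using abs_err_le(1)[OF adm K \<theta>] by (intro AE_I2) simp
  qed (use err_measurable(1)[OF adm] err_measurable(1)[OF adm0] in auto)
  assume m: "m \<in> {1..dsum l L}"
  show "(\<lambda>n. dloss (act n) (act' n) (\<theta> n) (unit_vec m)) \<longlonglongrightarrow> dloss act\<^sub>0 act'\<^sub>0 \<theta>\<^sub>0 (unit_vec m)"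
    unfolding dloss_def
  proof (rule integral_dominated_convergence[where w = "\<lambda>_. derr_bound C K"])
    show "AE x in \<mu>. (\<lambda>n. derr (act n) (act' n) (\<theta> n) (unit_vec m) x) \<longlonglongrightarrow> derr act\<^sub>0 act'\<^sub>0 \<theta>\<^sub>0 (unit_vec m) x"
      unfolding derr_def by (intro AE_I2 tendsto_intros real tang)
    show "AE x in \<mu>. norm (derr (act n) (act' n) (\<theta> n) (unit_vec m) x) \<le> derr_bound C K" for n
      using abs_err_le(2)[OF adm K \<theta> _ m] by (intro AE_I2) simp
  qed (use err_measurable(2)[OF adm] err_measurable(2)[OF adm0] in auto)
qed

text \<open>Aimed at the regularized activations: a continuous \<open>act'\<close> is what the ReLU
  derivative cannot offer.\<close>

lemma dloss_continuous:
  assumes adm: "admissible C act act'"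
    and cont: "\<And>k. continuous_on UNIV (act k)" "\<And>k. continuous_on UNIV (act' k)"
    and lim: "\<And>m. m \<in> {1..dsum l L} \<Longrightarrow> (\<lambda>n. \<theta> n m) \<longlonglongrightarrow> \<theta>\<^sub>0 m"
    and m: "m \<in> {1..dsum l L}"
  shows "(\<lambda>n. dloss act act' (\<theta> n) (unit_vec m)) \<longlonglongrightarrow> dloss act act' \<theta>\<^sub>0 (unit_vec m)"
proof -
  have "\<exists>K. \<forall>n. \<bar>\<theta> n m\<bar> \<le> K" if "m \<in> {1..dsum l L}" for m
    using convergent_imp_Bseq[OF convergentI[OF lim[OF that]]] by (auto simp: Bseq_def)
  then obtain k where k: "\<And>n m. m \<in> {1..dsum l L} \<Longrightarrow> \<bar>\<theta> n m\<bar> \<le> k m" by metis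
  obtain K where K: "0 \<le> K" "\<And>m. m \<in> {1..dsum l L} \<Longrightarrow> \<bar>k m\<bar> \<le> K" using params_bounded by blast
  have act0: "act 0 = (\<lambda>y. y)" using adm by (simp add: admissible_def)
  have iso: "isCont (act k) z" "isCont (act' k) z" for k z
    using cont by (auto simp: continuous_on_eq_continuous_at)
  note lims = realization_tangent_tendsto[where act = "\<lambda>_. act" and act' = "\<lambda>_. act'" and act\<^sub>0 = act
      and act'\<^sub>0 = act' and l = l and N = L and k = L and \<theta> = \<theta> and \<theta>\<^sub>0 = \<theta>\<^sub>0, OF act0 act0 lim
      isCont_tendsto_compose[OF iso(1)] isCont_tendsto_compose[OF iso(2)] order_refl]
  show ?thesis
    by (rule loss_dloss_tendsto(2)[where act = "\<lambda>_. act" and act' = "\<lambda>_. act'", OF adm adm K(1) _ lims m])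
       (use order_trans[OF k order_trans[OF abs_ge_self K(2)]] in blast)
qed

end

section \<open>The gradient flow\<close>

locale relu_loss = relu_approximation R A B C + loss_setting \<mu> l L y X
  for R :: "real \<Rightarrow> real \<Rightarrow> real" and A B C :: real
    and \<mu> :: "(nat \<Rightarrow> real) measure" and l :: "nat \<Rightarrow> nat" and L :: nat and y :: "nat \<Rightarrow> real" and X :: real
begin

lemma loss_dloss_reg_tendsto:
  shows "((\<lambda>r. loss (reg_act R r) \<theta>) \<longlongrightarrow> loss relu_act \<theta>) at_top"
    and "m \<in> {1..dsum l L} \<Longrightarrow> ((\<lambda>r. dloss (reg_act R r) (reg_act' R r) \<theta> (unit_vec m))
      \<longlongrightarrow> dloss relu_act relu_act' \<theta> (unit_vec m)) at_top"
proof -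
  obtain K where K: "0 \<le> K" "\<And>m. m \<in> {1..dsum l L} \<Longrightarrow> \<bar>\<theta> m\<bar> \<le> K" using params_bounded by blast
  have seq: "(\<lambda>n. loss (reg_act R (Z n)) \<theta>) \<longlonglongrightarrow> loss relu_act \<theta> \<and>
      (m \<in> {1..dsum l L} \<longrightarrow> (\<lambda>n. dloss (reg_act R (Z n)) (reg_act' R (Z n)) \<theta> (unit_vec m))
        \<longlonglongrightarrow> dloss relu_act relu_act' \<theta> (unit_vec m))"
    if Z: "filterlim Z at_top sequentially" and Z1: "\<And>n. Z n \<ge> 1" for Z :: "nat \<Rightarrow> real" and m
    using loss_dloss_tendsto[where act = "\<lambda>n. reg_act R (Z n)" and act' = "\<lambda>n. reg_act' R (Z n)" and \<theta> = "\<lambda>_. \<theta>",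
        OF admissible_reg[OF Z1] admissible_relu[OF C_ge_1] K
          filterlim_compose[OF realization_tangent_reg_tendsto(1) Z]
          filterlim_compose[OF realization_tangent_reg_tendsto(2) Z]]
    by blast
  \<comment> \<open>Admissibility is known only from 1 on, whereas an arbitrary sequence tending to
    infinity may start lower. Replacing it by its maximum with 1 changes it only at finitely many
    places.\<close>
  have to_max: "filterlim (\<lambda>n. max 1 (Z n)) at_top sequentially"
      "\<forall>\<^sub>F n in sequentially. max 1 (Z n) = Z n"
    if "filterlim Z at_top sequentially" for Z :: "nat \<Rightarrow> real"
  proof -
    show "filterlim (\<lambda>n. max 1 (Z n)) at_top sequentially"
      by (rule filterlim_at_top_mono[OF that]) simp
    have "\<forall>\<^sub>F n in sequentially. Z n \<ge> 1" using that by (simp add: filterlim_at_top)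
    then show "\<forall>\<^sub>F n in sequentially. max 1 (Z n) = Z n" by eventually_elim simp
  qed
  show "((\<lambda>r. loss (reg_act R r) \<theta>) \<longlongrightarrow> loss relu_act \<theta>) at_top"
  proof (rule tendsto_at_topI_sequentially)
    fix Z :: "nat \<Rightarrow> real" assume Z: "filterlim Z at_top sequentially"
    show "(\<lambda>n. loss (reg_act R (Z n)) \<theta>) \<longlonglongrightarrow> loss relu_act \<theta>"
      by (rule Lim_transform_eventually[OF conjunct1[OF seq[OF to_max(1)[OF Z] max.cobounded1]]])
         (use to_max(2)[OF Z] in eventually_elim, simp)
  qed
  show "((\<lambda>r. dloss (reg_act R r) (reg_act' R r) \<theta> (unit_vec m))
      \<longlongrightarrow> dloss relu_act relu_act' \<theta> (unit_vec m)) at_top" if m: "m \<in> {1..dsum l L}"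
  proof (rule tendsto_at_topI_sequentially)
    fix Z :: "nat \<Rightarrow> real" assume Z: "filterlim Z at_top sequentially"
    show "(\<lambda>n. dloss (reg_act R (Z n)) (reg_act' R (Z n)) \<theta> (unit_vec m))
      \<longlonglongrightarrow> dloss relu_act relu_act' \<theta> (unit_vec m)"
      by (rule Lim_transform_eventually[OF mp[OF conjunct2[OF seq[OF to_max(1)[OF Z] max.cobounded1]] m]])
         (use to_max(2)[OF Z] in eventually_elim, simp)
  qed
qed

end

text \<open>The velocity is the explicit generalized gradient; the identification of
  \<open>G\<close> with it precedes the instantiation.\<close>

locale relu_gradient_flow = relu_loss +
  fixes p :: "real \<Rightarrow> nat \<Rightarrow> real"
  assumes L_pos: "0 < L"
    and p_cont: "\<And>m. m \<in> {1..dsum l L} \<Longrightarrow> continuous_on {0..} (\<lambda>t. p t m)"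
    and flow_integrable: "\<And>t m. 0 \<le> t \<Longrightarrow> m \<in> {1..dsum l L} \<Longrightarrow>
      (\<lambda>s. dloss relu_act relu_act' (p s) (unit_vec m)) absolutely_integrable_on {0..t}"
    and flow: "\<And>t m. 0 \<le> t \<Longrightarrow> m \<in> {1..dsum l L} \<Longrightarrow>
      p t m = p 0 m - integral {0..t} (\<lambda>s. dloss relu_act relu_act' (p s) (unit_vec m))"
begin

abbreviation g :: "real \<Rightarrow> nat \<Rightarrow> real" where
  "g s m \<equiv> dloss relu_act relu_act' (p s) (unit_vec m)"

lemma path_bounded:
  "\<exists>K\<ge>0. \<forall>s\<in>{0..T}. \<forall>m\<in>{1..dsum l L}. \<bar>p s m\<bar> \<le> K"
proof -
  have "\<exists>K. \<forall>s\<in>{0..T}. \<bar>p s m\<bar> \<le> K" if m: "m \<in> {1..dsum l L}" for m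
  proof -
    have "bounded ((\<lambda>t. p t m) ` {0..T})"
      by (intro compact_imp_bounded compact_continuous_image continuous_on_subset[OF p_cont[OF m]]) auto
    then show ?thesis by (auto simp: bounded_iff)
  qed
  then obtain k where k: "\<And>m s. m \<in> {1..dsum l L} \<Longrightarrow> s \<in> {0..T} \<Longrightarrow> \<bar>p s m\<bar> \<le> k m" by metis
  obtain K where K: "0 \<le> K" "\<And>m. m \<in> {1..dsum l L} \<Longrightarrow> \<bar>k m\<bar> \<le> K" using params_bounded by blast
  show ?thesis
    using K(1) order_trans[OF k order_trans[OF abs_ge_self K(2)]] by blast
qed

text \<open>On [0,T] the continuous path is bounded, hence so is its velocity \<open>- g\<close>.
  The two uses are the regularized losses and the Lyapunov function.\<close>

lemma flow_chain_rule:
  assumes T: "0 \<le> T"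
    and deriv: "\<And>\<theta> \<eta> h. ((\<lambda>h. F (\<lambda>m. \<theta> m + h * \<eta> m)) has_real_derivative
        (\<Sum>m=1..dsum l L. dF (\<lambda>m. \<theta> m + h * \<eta> m) m * \<eta> m)) (at h)"
    and cont: "\<And>X \<theta> m. (\<And>m. m \<in> {1..dsum l L} \<Longrightarrow> (\<lambda>n. X n m) \<longlonglongrightarrow> \<theta> m) \<Longrightarrow> m \<in> {1..dsum l L} \<Longrightarrow>
        (\<lambda>n. dF (X n) m) \<longlonglongrightarrow> dF \<theta> m"
  shows "(\<lambda>s. \<Sum>m=1..dsum l L. dF (p s) m * g s m) integrable_on {0..T}"
    and "F (p T) = F (p 0) - integral {0..T} (\<lambda>s. \<Sum>m=1..dsum l L. dF (p s) m * g s m)"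
proof -
  obtain K where K: "0 \<le> K" "\<And>s m. s \<in> {0..T} \<Longrightarrow> m \<in> {1..dsum l L} \<Longrightarrow> \<bar>p s m\<bar> \<le> K"
    using path_bounded by blast
  have g_bound: "\<bar>- g s m\<bar> \<le> derr_bound C K * measure \<mu> (space \<mu>)" if "s \<in> {0..T}" "m \<in> {1..dsum l L}" for s m
    using abs_dloss_le[OF admissible_relu[OF C_ge_1] K(1) K(2)[OF that(1)] that(2)] by simp
  have path: "p t m = p 0 m + integral {0..t} (\<lambda>s. - g s m)" if "t \<in> {0..T}" "m \<in> {1..dsum l L}" for t m
    using flow[of t m] that by simp
  have q_int: "(\<lambda>s. - g s m) absolutely_integrable_on {0..T}" if "m \<in> {1..dsum l L}" for m
    using absolutely_integrable_scaleR_left[OF flow_integrable[OF T that], of "-1"] by simp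
  note ch = chain_rule_integral_path[where F = F and dF = dF and p = p and q = "\<lambda>s m. - g s m",
      OF finite_atLeastAtMost T deriv cont q_int g_bound path]
  have "(\<lambda>s. \<Sum>m=1..dsum l L. dF (p s) m * - g s m) integrable_on {0..T}"
    using ch(1) by (rule set_lebesgue_integral_eq_integral(1))
  then have i: "(\<lambda>s. - (\<Sum>m=1..dsum l L. dF (p s) m * g s m)) integrable_on {0..T}"
    by (simp add: sum_negf)
  then show "(\<lambda>s. \<Sum>m=1..dsum l L. dF (p s) m * g s m) integrable_on {0..T}"
    by (simp add: integrable_neg_iff)
  show "F (p T) = F (p 0) - integral {0..T} (\<lambda>s. \<Sum>m=1..dsum l L. dF (p s) m * g s m)"
    using ch(2) by (simp add: sum_negf)
qed

text \<open>Along the flow each regularized loss changes by the integral of its gradient paired with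
  \<open>- g\<close>. Since that gradient tends to \<open>g\<close> pointwise in time and all
  products are bounded by \<open>M * M\<close>, the limit of the integrals is the integral of the
  squared norm of \<open>g\<close>.\<close>

lemma loss_dissipation:
  assumes T: "0 \<le> T"
  shows "(\<lambda>s. \<Sum>m=1..dsum l L. (g s m)\<^sup>2) integrable_on {0..T}"
    and "loss relu_act (p T) = loss relu_act (p 0) - integral {0..T} (\<lambda>s. \<Sum>m=1..dsum l L. (g s m)\<^sup>2)"
proof -
  obtain K where K: "0 \<le> K" "\<And>s m. s \<in> {0..T} \<Longrightarrow> m \<in> {1..dsum l L} \<Longrightarrow> \<bar>p s m\<bar> \<le> K"
    using path_bounded by blast
  define M where "M = derr_bound C K * measure \<mu> (space \<mu>)"
  let ?r = "\<lambda>n. real (Suc n)"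
  let ?a = "\<lambda>n s m. dloss (reg_act R (?r n)) (reg_act' R (?r n)) (p s) (unit_vec m)"
  let ?f = "\<lambda>n s. \<Sum>m=1..dsum l L. ?a n s m * g s m"
  have r1: "?r n \<ge> 1" for n by simp
  have r_lim: "filterlim ?r at_top sequentially"
    using filterlim_real_sequentially filterlim_Suc by (rule filterlim_compose)
  note ch = flow_chain_rule[OF T, where F = "loss (reg_act R (?r n))"
      and dF = "\<lambda>\<theta> m. dloss (reg_act R (?r n)) (reg_act' R (?r n)) \<theta> (unit_vec m)" for n,
      OF loss_has_derivative[OF admissible_reg[OF r1] reg_act_has_derivative[OF r1]]
        dloss_continuous[OF admissible_reg[OF r1] continuous_reg_act[OF r1] continuous_reg_act'[OF r1]]]
  have bound: "norm (?f n s) \<le> (\<Sum>m=1..dsum l L. M * M)" if s: "s \<in> {0..T}" for n s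
  proof -
    have "\<bar>?a n s m * g s m\<bar> \<le> M * M" if m: "m \<in> {1..dsum l L}" for m
      unfolding abs_mult
    proof (rule mult_mono')
      show "\<bar>?a n s m\<bar> \<le> M" unfolding M_def
        by (rule abs_dloss_le[OF admissible_reg[OF r1] K(1) K(2)[OF s] m])
      show "\<bar>g s m\<bar> \<le> M" unfolding M_def
        by (rule abs_dloss_le[OF admissible_relu[OF C_ge_1] K(1) K(2)[OF s] m])
    qed auto
    then show ?thesis unfolding real_norm_def by (intro order_trans[OF sum_abs sum_mono])
  qed
  have lim: "(\<lambda>n. ?f n s) \<longlonglongrightarrow> (\<Sum>m=1..dsum l L. (g s m)\<^sup>2)" for s
    unfolding power2_eq_square
    by (intro tendsto_intros filterlim_compose[OF loss_dloss_reg_tendsto(2) r_lim])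
  note dct = dominated_convergence[where f = ?f and S = "{0..T}" and h = "\<lambda>_. \<Sum>m=1..dsum l L. M * M",
      OF ch(1) integrable_const_ivl bound lim]
  show "(\<lambda>s. \<Sum>m=1..dsum l L. (g s m)\<^sup>2) integrable_on {0..T}" by (rule dct(1))
  have eq: "loss (reg_act R (?r n)) (p T) = loss (reg_act R (?r n)) (p 0) - integral {0..T} (?f n)" for n
    by (rule ch(2))
  have "(\<lambda>n. loss (reg_act R (?r n)) (p T))
      \<longlonglongrightarrow> loss relu_act (p 0) - integral {0..T} (\<lambda>s. \<Sum>m=1..dsum l L. (g s m)\<^sup>2)"
    unfolding eq by (intro tendsto_diff dct(2) filterlim_compose[OF loss_dloss_reg_tendsto(1) r_lim])
  with filterlim_compose[OF loss_dloss_reg_tendsto(1) r_lim]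
  show "loss relu_act (p T) = loss relu_act (p 0) - integral {0..T} (\<lambda>s. \<Sum>m=1..dsum l L. (g s m)\<^sup>2)"
    by (rule LIMSEQ_unique)
qed

lemma loss_antimono:
  assumes "0 \<le> s" "s \<le> t" shows "loss relu_act (p t) \<le> loss relu_act (p s)"
proof -
  have "integral {0..s} (\<lambda>s. \<Sum>m=1..dsum l L. (g s m)\<^sup>2) \<le> integral {0..t} (\<lambda>s. \<Sum>m=1..dsum l L. (g s m)\<^sup>2)"
    using assms loss_dissipation(1) by (intro integral_subset_le) (auto intro: sum_nonneg)
  then show ?thesis using loss_dissipation(2)[of s] loss_dissipation(2)[of t] assms by simp
qed

lemma loss_nonneg: "0 \<le> loss act \<theta>"
  unfolding loss_def err_def by (intro integral_nonneg_AE AE_I2 sum_nonneg) auto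

text \<open>\<^const>\<open>Vfun\<close> in terms of the coordinates of the parameter vector: \<open>c\<close> is \<open>k\<close> at the biases of
  layer \<open>k\<close> and 1 at the weights, and \<open>w\<close> is the target at the last biases and 0 elsewhere.\<close>

definition lyapunov :: "(nat \<Rightarrow> real) \<Rightarrow> (nat \<Rightarrow> real) \<Rightarrow> (nat \<Rightarrow> real) \<Rightarrow> real" where
  "lyapunov c w \<theta> = (\<Sum>m=1..dsum l L. c m * (\<theta> m)\<^sup>2 - 2 * real L * w m * \<theta> m)"

lemma lyapunov_decrease:
  assumes c: "\<And>k i. k < L \<Longrightarrow> i \<in> {1..l (Suc k)} \<Longrightarrow> c (bidx l k i) = real (Suc k)"
      "\<And>k i j. k < L \<Longrightarrow> i \<in> {1..l (Suc k)} \<Longrightarrow> j \<in> {1..l k} \<Longrightarrow> c (widx l k i j) = 1"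
    and w: "\<And>k i. k < L \<Longrightarrow> i \<in> {1..l (Suc k)} \<Longrightarrow> w (bidx l k i) = (if Suc k = L then y i else 0)"
      "\<And>k i j. k < L \<Longrightarrow> i \<in> {1..l (Suc k)} \<Longrightarrow> j \<in> {1..l k} \<Longrightarrow> w (widx l k i j) = 0"
    and t: "0 \<le> t"
  shows "lyapunov c w (p t) \<le> lyapunov c w (p 0) - 4 * real L * t * loss relu_act (p t)"
proof -
  define dV where "dV \<theta> m = 2 * c m * \<theta> m - 2 * real L * w m" for \<theta> :: "nat \<Rightarrow> real" and m
  obtain L' where L': "L = Suc L'" using L_pos by (cases L) auto
  have tang: "tangent l relu_act relu_act' \<theta> (dV \<theta>) L x i = 2 * real L * (realization l relu_act \<theta> L x i - y i)"
    if i: "i \<in> {1..l L}" for \<theta> x i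
  proof -
    \<comment> \<open>At the last biases the gradient of \<open>V\<close> is 2 L (\<theta> - y), so
      the shift in Euler's identity is \<open>L * y\<close>, and the factor L comes out of N -
      y.\<close>
    have "tangent l relu_act relu_act' \<theta> (dV \<theta>) (Suc L') x i
      = 2 * (real (Suc L') * realization l relu_act \<theta> (Suc L') x i - (if Suc L' = L then real L * y i else 0))"
      by (rule tangent_relu_homogeneous[where n = L and c = "\<lambda>k i. if Suc k = L then real L * y i else 0"])
         (use c w i L' in \<open>auto simp: dV_def\<close>)
    then show ?thesis by (simp add: L' algebra_simps)
  qed
  \<comment> \<open>The factor 4 L is 2 from differentiating the square times 2 L from
    \<open>tang\<close>.\<close>
  have pairing: "(\<Sum>m=1..dsum l L. dV (p s) m * g s m) = 4 * real L * loss relu_act (p s)" for s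
  proof -
    have "(\<Sum>m=1..dsum l L. dV (p s) m * g s m) = dloss relu_act relu_act' (p s) (dV (p s))"
      unfolding dloss_linear[OF admissible_relu[OF C_ge_1], of _ "dV (p s)"] by (simp add: mult.commute)
    also have "\<dots> = (\<integral>x. 4 * real L * err relu_act (p s) x \<partial>\<mu>)"
      unfolding dloss_def derr_def err_def
      by (intro Bochner_Integration.integral_cong refl, unfold sum_distrib_left, intro sum.cong refl,
          simp only: tang power2_eq_square, simp add: algebra_simps)
    also have "\<dots> = 4 * real L * loss relu_act (p s)" by (simp add: loss_def)
    finally show ?thesis .
  qed
  have deriv: "((\<lambda>h. lyapunov c w (\<lambda>m. \<theta> m + h * \<eta> m)) has_real_derivative
      (\<Sum>m=1..dsum l L. dV (\<lambda>m. \<theta> m + h * \<eta> m) m * \<eta> m)) (at h)" for \<theta> \<eta> :: "nat \<Rightarrow> real" and h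
    unfolding lyapunov_def dV_def
    by (auto intro!: derivative_eq_intros sum.cong simp: algebra_simps)
  have cont: "(\<lambda>n. dV (Y n) m) \<longlonglongrightarrow> dV \<theta> m"
    if "\<And>m. m \<in> {1..dsum l L} \<Longrightarrow> (\<lambda>n. Y n m) \<longlonglongrightarrow> \<theta> m" "m \<in> {1..dsum l L}"
    for Y :: "nat \<Rightarrow> nat \<Rightarrow> real" and \<theta> m
    unfolding dV_def using that(2) by (intro tendsto_diff tendsto_mult tendsto_const that(1))
  note ch = flow_chain_rule[OF t, where F = "lyapunov c w" and dF = dV, OF deriv cont]
  have "integral {0..t} (\<lambda>s. 4 * real L * loss relu_act (p t))
      \<le> integral {0..t} (\<lambda>s. \<Sum>m=1..dsum l L. dV (p s) m * g s m)"
    by (rule integral_le[OF integrable_const_ivl ch(1)])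
       (unfold pairing, use loss_antimono in \<open>auto intro!: mult_left_mono\<close>)
  then show ?thesis using ch(2) t by (simp add: mult_ac)
qed

end

section \<open>Instantiation in the setting of the theorem, and the explicit constants\<close>

theorem theorem3p8:
  fixes l :: "nat \<Rightarrow> nat" and L :: nat and a b A B :: real
    and R :: "real \<Rightarrow> real \<Rightarrow> real"
    and \<mu> :: "(nat \<Rightarrow> real) measure"
    and f :: "(nat \<Rightarrow> real) \<Rightarrow> (nat \<Rightarrow> real)"
    and G :: "(nat \<Rightarrow> real) \<Rightarrow> (nat \<Rightarrow> real)"
    and \<Theta> :: "real \<Rightarrow> (nat \<Rightarrow> real)"
  defines "d \<equiv> dsum l L"
  assumes L_pos: "L \<ge> 1"
    and l_pos: "\<forall>k. l k \<ge> 1"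
    and ab: "a < b"
    and AB: "0 < A" "A < B"
    and R_C1: "\<forall>r\<ge>1. R r C1_differentiable_on UNIV"
    and R_zero: "\<forall>r\<ge>1. \<forall>x. x \<le> A / r \<longrightarrow> R r x = 0"
    and R_bnd: "\<forall>r\<ge>1. \<forall>y. 0 \<le> R r y \<and> R r y \<le> max y 0"
    and R_id: "\<forall>r\<ge>1. \<forall>z. z \<ge> B / r \<longrightarrow> R r z = z"
    and R_deriv: "\<exists>C. \<forall>r\<ge>1. \<forall>x. \<bar>deriv (R r) x\<bar> \<le> C"
    and mu_space: "space \<mu> = cube (l 0) a b"
    and mu_sets: "sets \<mu> = sets (restrict_space borel (cube (l 0) a b))"
    and mu_fin: "finite_measure \<mu>"
    and f_meas: "\<forall>i\<in>{1..l L}. (\<lambda>x. f x i) \<in> borel_measurable \<mu>"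
    and int_r: "\<forall>r\<ge>1. \<forall>\<theta>. integrable \<mu> (sq_err l L (NN_r l R r \<theta> L) f)"
    and int_inf: "\<forall>\<theta>. integrable \<mu> (sq_err l L (NN_inf l \<theta> L) f)"
    and G_lim: "\<forall>\<theta> v. (\<forall>i\<in>{1..d}. ((\<lambda>r. grad (loss_r l L R \<mu> f r) \<theta> i) \<longlongrightarrow> v i) at_top)
                  \<longrightarrow> (\<forall>i\<in>{1..d}. G \<theta> i = v i)"
    and f_const: "\<forall>x\<in>cube (l 0) a b. \<forall>i\<in>{1..l L}. f x i = f (\<lambda>_. 0) i"
    and \<Theta>_cont: "\<forall>i\<in>{1..d}. continuous_on {0..} (\<lambda>t. \<Theta> t i)"
    and \<Theta>_int: "\<forall>t\<ge>0. \<forall>i\<in>{1..d}. set_integrable lborel {0..t} (\<lambda>s. G (\<Theta> s) i)"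
    and \<Theta>_eq: "\<forall>t\<ge>0. \<forall>i\<in>{1..d}. \<Theta> t i = \<Theta> 0 i - (LINT s:{0..t}|lborel. G (\<Theta> s) i)"
  shows "(\<forall>t\<ge>0. vnorm d (\<Theta> t) \<le> sqrt (2 * Vfun l L f (\<Theta> 0) + 4 * (real L)\<^sup>2 * (vnorm (l L) (f (\<lambda>_. 0)))\<^sup>2))
       \<and> (\<forall>t>0. loss_inf l L \<mu> f (\<Theta> t)
                \<le> 1 / (2 * t) * ((vnorm d (\<Theta> 0))\<^sup>2 + 2 * real L * (vnorm (l L) (f (\<lambda>_. 0)))\<^sup>2))
       \<and> Limsup at_top (\<lambda>t. ereal (loss_inf l L \<mu> f (\<Theta> t))) = 0"
proof -
  define y where "y = f (\<lambda>_. 0)"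
  obtain C0 where C0: "\<And>r x. r \<ge> 1 \<Longrightarrow> \<bar>deriv (R r) x\<bar> \<le> C0" using R_deriv by blast
  define C where "C = max 1 C0"
  interpret finite_measure \<mu> by (rule mu_fin)
  interpret relu_approximation R A B C
  proof
    show "\<bar>deriv (R r) x\<bar> \<le> C" if "r \<ge> 1" for r x
      using C0[OF that, of x] by (simp add: C_def)
  qed (use AB R_C1 R_zero R_bnd R_id in \<open>auto simp: C_def\<close>)
  interpret loss_setting \<mu> l L y "\<bar>a\<bar> + \<bar>b\<bar>"
  proof
    fix j assume j: "j \<in> {1..l 0}"
    have "(\<lambda>x. x j) \<in> borel_measurable (borel :: (nat \<Rightarrow> real) measure)"
      by (intro borel_measurable_continuous_onI continuous_on_product_coordinates)
    then have "(\<lambda>x. x j) \<in> borel_measurable (restrict_space borel (cube (l 0) a b))"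
      by (rule measurable_restrict_space1)
    then show "(\<lambda>x. x j) \<in> borel_measurable \<mu>"
      using measurable_cong_sets[OF mu_sets refl, of "borel :: real measure"] by blast
    show "\<bar>x j\<bar> \<le> \<bar>a\<bar> + \<bar>b\<bar>" if "x \<in> space \<mu>" for x
    proof -
      have "x j \<in> {a..b}" using that j by (auto simp: mu_space cube_def)
      then show ?thesis by auto
    qed
  qed simp
  interpret relu_loss R A B C \<mu> l L y "\<bar>a\<bar> + \<bar>b\<bar>" ..
  have sq_err: "sq_err l L N f x = (\<Sum>i=1..l L. (N x i - y i)\<^sup>2)" if "x \<in> space \<mu>" for N x
  proof -
    have "sq_err l L N f x = (\<Sum>i=1..l L. (N x i - f x i)\<^sup>2)"
      unfolding sq_err_def vnorm_def by (rule real_sqrt_pow2) (intro sum_nonneg zero_le_power2)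
    also have "\<dots> = (\<Sum>i=1..l L. (N x i - y i)\<^sup>2)"
      using f_const that by (intro sum.cong) (auto simp: mu_space y_def)
    finally show ?thesis .
  qed
  have loss_r: "loss_r l L R \<mu> f r = loss (reg_act R r)" for r
    unfolding loss_r_def loss_def err_def
    by (intro ext Bochner_Integration.integral_cong refl) (simp add: sq_err NN_r_eq)
  have loss_inf: "loss_inf l L \<mu> f = loss relu_act"
    unfolding loss_inf_def loss_def err_def
    by (intro ext Bochner_Integration.integral_cong refl) (simp add: sq_err NN_inf_eq)
  have grad_r: "grad (loss_r l L R \<mu> f r) \<theta> m = dloss (reg_act R r) (reg_act' R r) \<theta> (unit_vec m)"
    if r: "r \<ge> 1" and m: "m \<in> {1..dsum l L}" for r \<theta> m
  proof -
    have "((\<lambda>h. loss (reg_act R r) (\<lambda>p. \<theta> p + h * unit_vec m p)) has_real_derivative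
        (\<Sum>p=1..dsum l L. dloss (reg_act R r) (reg_act' R r) (\<lambda>p. \<theta> p + 0 * unit_vec m p) (unit_vec p) * unit_vec m p)) (at 0)"
      by (rule loss_has_derivative[OF admissible_reg[OF r] reg_act_has_derivative[OF r]])
    moreover have "(\<lambda>p. \<theta> p + h * unit_vec m p) = \<theta>(m := \<theta> m + h)" for h by auto
    moreover have "(\<Sum>p=1..dsum l L. D p * unit_vec m p) = D m" for D :: "nat \<Rightarrow> real"
      using m by (simp add: if_distrib cong: if_cong)
    ultimately show ?thesis
      unfolding grad_def loss_r by (intro DERIV_imp_deriv) simp
  qed
  have G: "G \<theta> m = dloss relu_act relu_act' \<theta> (unit_vec m)" if m: "m \<in> {1..dsum l L}" for \<theta> m
  proof -
    \<comment> \<open>The hypothesis on \<open>G\<close> speaks of the gradient as a vector, so all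
      coordinates must be shown to converge before one of them can be read off.\<close>
    have "((\<lambda>r. grad (loss_r l L R \<mu> f r) \<theta> m) \<longlongrightarrow> dloss relu_act relu_act' \<theta> (unit_vec m)) at_top"
      if m: "m \<in> {1..dsum l L}" for m
    proof (rule Lim_transform_eventually[OF loss_dloss_reg_tendsto(2)[OF m]])
      show "\<forall>\<^sub>F r in at_top. dloss (reg_act R r) (reg_act' R r) \<theta> (unit_vec m) = grad (loss_r l L R \<mu> f r) \<theta> m"
        using eventually_ge_at_top[of 1]
      proof eventually_elim
        case (elim r)
        then show ?case using grad_r[OF elim m, of \<theta>] by simp
      qed
    qed
    then show ?thesis
      by (rule G_lim[unfolded d_def, rule_format, of \<theta> "\<lambda>m. dloss relu_act relu_act' \<theta> (unit_vec m)"]) (assumption | rule m)+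
  qed
  have L_pos': "0 < L" using L_pos by simp
  have abs_int: "(\<lambda>s. dloss relu_act relu_act' (\<Theta> s) (unit_vec m)) absolutely_integrable_on {0..t}"
    "\<Theta> t m = \<Theta> 0 m - integral {0..t} (\<lambda>s. dloss relu_act relu_act' (\<Theta> s) (unit_vec m))"
    if t: "0 \<le> t" and m: "m \<in> {1..dsum l L}" for t m
  proof -
    have i: "set_integrable lborel {0..t} (\<lambda>s. G (\<Theta> s) m)" using \<Theta>_int t m by (simp add: d_def)
    have eq: "(\<lambda>s. G (\<Theta> s) m) = (\<lambda>s. dloss relu_act relu_act' (\<Theta> s) (unit_vec m))"
      using G[OF m] by simp
    have "set_integrable lebesgue {0..t} (\<lambda>s. G (\<Theta> s) m)"
      using i by (simp add: set_integrable_def integrable_completion)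
    then show "(\<lambda>s. dloss relu_act relu_act' (\<Theta> s) (unit_vec m)) absolutely_integrable_on {0..t}"
      unfolding eq .
    show "\<Theta> t m = \<Theta> 0 m - integral {0..t} (\<lambda>s. dloss relu_act relu_act' (\<Theta> s) (unit_vec m))"
      using \<Theta>_eq[rule_format, OF t, of m] m
      unfolding eq set_borel_integral_eq_integral(2)[OF i, unfolded eq] d_def by blast
  qed
  interpret relu_gradient_flow R A B C \<mu> l L y "\<bar>a\<bar> + \<bar>b\<bar>" \<Theta>
    by unfold_locales (fact L_pos' \<Theta>_cont[unfolded d_def, rule_format] abs_int)+
  obtain c0 where c0: "\<And>k i. k < L \<Longrightarrow> i \<in> {1..l (Suc k)} \<Longrightarrow> c0 (bidx l k i) = real (Suc k)"
      "\<And>k i j. k < L \<Longrightarrow> i \<in> {1..l (Suc k)} \<Longrightarrow> j \<in> {1..l k} \<Longrightarrow> c0 (widx l k i j) = (1::real)"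
    using params_exist[of L l "\<lambda>k i. real (Suc k)" "\<lambda>_ _ _. 1"] by blast
  obtain w where w: "\<And>k i. k < L \<Longrightarrow> i \<in> {1..l (Suc k)} \<Longrightarrow> w (bidx l k i) = (if Suc k = L then y i else 0)"
      "\<And>k i j. k < L \<Longrightarrow> i \<in> {1..l (Suc k)} \<Longrightarrow> j \<in> {1..l k} \<Longrightarrow> w (widx l k i j) = (0::real)"
    using params_exist[of L l "\<lambda>k i. if Suc k = L then y i else 0" "\<lambda>_ _ _. 0"] by blast
  \<comment> \<open>Nothing is known about \<open>c0\<close> off the parameter indices. Clamping to
    [1,L] makes the bounds hold for every index and changes no prescribed value, as these already
    lie in that range.\<close>
  define c where "c m = max 1 (min (real L) (c0 m))" for m
  have c_bounds: "1 \<le> c m" "c m \<le> real L" for m using L_pos by (auto simp: c_def)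
  have c: "c (bidx l k i) = real (Suc k)" if "k < L" "i \<in> {1..l (Suc k)}" for k i
    using that c0(1)[OF that] by (simp add: c_def)
  have c': "c (widx l k i j) = 1" if "k < L" "i \<in> {1..l (Suc k)}" "j \<in> {1..l k}" for k i j
    using L_pos c0(2)[OF that] by (simp add: c_def)
  have decrease: "lyapunov c w (\<Theta> t) \<le> lyapunov c w (\<Theta> 0) - 4 * real L * t * loss relu_act (\<Theta> t)"
    if "0 \<le> t" for t
    by (rule lyapunov_decrease) (fact c c' w that)+
  have V: "Vfun l L f \<theta> = lyapunov c w \<theta>" for \<theta>
  proof -
    have "vinner (l L) y (bias l L \<theta>) = (\<Sum>k<L. \<Sum>i=1..l (Suc k). (if Suc k = L then y i else 0) * \<theta> (bidx l k i))"
    proof -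
      obtain L' where L': "L = Suc L'" using L_pos' by (cases L) auto
      show ?thesis unfolding L' by (simp add: vinner_def bias_Suc)
    qed
    moreover have "(\<Sum>k=1..L. real k * (vnorm (l k) (bias l k \<theta>))\<^sup>2
          + (\<Sum>i=1..l k. \<Sum>j=1..l (k - 1). (wgt l k \<theta> i j)\<^sup>2))
        = (\<Sum>k<L. real (Suc k) * (\<Sum>i=1..l (Suc k). (\<theta> (bidx l k i))\<^sup>2)
          + (\<Sum>i=1..l (Suc k). \<Sum>j=1..l k. (\<theta> (widx l k i j))\<^sup>2))"
      unfolding One_nat_def by (subst sum.atLeast1_atMost_eq)
        (simp add: vnorm_def sum_nonneg wgt_Suc bias_Suc)
    ultimately have "Vfun l L f \<theta> = (\<Sum>k<L. (\<Sum>i=1..l (Suc k). \<Sum>j=1..l k. (\<theta> (widx l k i j))\<^sup>2)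
        + (\<Sum>i=1..l (Suc k). real (Suc k) * (\<theta> (bidx l k i))\<^sup>2
            - 2 * real L * ((if Suc k = L then y i else 0) * \<theta> (bidx l k i))))"
      unfolding Vfun_def y_def[symmetric]
      by (simp only: sum_distrib_left sum.distrib sum_subtractf)
    also have "\<dots> = (\<Sum>k<L. (\<Sum>i=1..l (Suc k). \<Sum>j=1..l k.
          c (widx l k i j) * (\<theta> (widx l k i j))\<^sup>2 - 2 * real L * w (widx l k i j) * \<theta> (widx l k i j))
        + (\<Sum>i=1..l (Suc k).
          c (bidx l k i) * (\<theta> (bidx l k i))\<^sup>2 - 2 * real L * w (bidx l k i) * \<theta> (bidx l k i)))"
      by (intro sum.cong arg_cong2[where f = "(+)"] refl) (simp_all add: c c' w)
    also have "\<dots> = lyapunov c w \<theta>"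
      unfolding lyapunov_def by (rule sum_params[symmetric])
    finally show ?thesis .
  qed
  have norm_y: "(vnorm (l L) y)\<^sup>2 = (\<Sum>m=1..dsum l L. (w m)\<^sup>2)"
  proof -
    obtain L' where L': "L = Suc L'" using L_pos' by (cases L) auto
    have "(\<Sum>m=1..dsum l L. (w m)\<^sup>2) = (\<Sum>k<L. (\<Sum>i=1..l (Suc k). (if Suc k = L then y i else 0)\<^sup>2))"
      unfolding sum_params by (intro sum.cong refl) (simp add: w)
    also have "\<dots> = (\<Sum>i=1..l L. (y i)\<^sup>2)" unfolding L' by simp
    finally show ?thesis by (simp add: vnorm_def sum_nonneg)
  qed
  have norm_\<theta>: "(vnorm (dsum l L) \<theta>)\<^sup>2 = (\<Sum>m=1..dsum l L. (\<theta> m)\<^sup>2)" for \<theta>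
    by (simp add: vnorm_def sum_nonneg)
  \<comment> \<open>Coordinatewise, right side minus left side is the square of \<theta> - 2 L w
    plus 2 (c - 1) \<theta>^2, nonnegative because c is at least 1.\<close>
  have V_lower: "(\<Sum>m=1..dsum l L. (\<theta> m)\<^sup>2) \<le> 2 * lyapunov c w \<theta> + 4 * (real L)\<^sup>2 * (vnorm (l L) y)\<^sup>2" for \<theta>
    unfolding norm_y lyapunov_def sum_distrib_left sum.distrib[symmetric]
  proof (rule sum_mono)
    fix m
    have "0 \<le> (\<theta> m - 2 * real L * w m)\<^sup>2 + 2 * ((c m - 1) * (\<theta> m)\<^sup>2)" using c_bounds(1)[of m] by simp
    then show "(\<theta> m)\<^sup>2 \<le> 2 * (c m * (\<theta> m)\<^sup>2 - 2 * real L * w m * \<theta> m) + 4 * (real L)\<^sup>2 * (w m)\<^sup>2"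
      by (simp add: power2_eq_square algebra_simps)
  qed
  \<comment> \<open>The terms in \<eta> are at least - L^2 w^2, as c is at least 1; those in
    \<theta> are at most 2 L \<theta>^2 + L w^2, as c is at most L. Since L is at least 1, the
    leftover (L + L^2) w^2 is below 4 L^2 w^2.\<close>
  have V_diff: "lyapunov c w \<theta> - lyapunov c w \<eta>
      \<le> 2 * real L * ((vnorm (dsum l L) \<theta>)\<^sup>2 + 2 * real L * (vnorm (l L) y)\<^sup>2)" for \<theta> \<eta>
    unfolding norm_y norm_\<theta> lyapunov_def sum_distrib_left sum.distrib[symmetric] sum_subtractf[symmetric]
  proof (rule sum_mono)
    fix m
    have L1: "1 \<le> real L" using L_pos by simp
    have "0 \<le> (\<eta> m - real L * w m)\<^sup>2 + (c m - 1) * (\<eta> m)\<^sup>2" using c_bounds(1)[of m] by simp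
    moreover have "0 \<le> real L * (\<theta> m + w m)\<^sup>2 + (real L - c m) * (\<theta> m)\<^sup>2" using c_bounds(2)[of m] by simp
    moreover have "real L * (w m)\<^sup>2 + (real L)\<^sup>2 * (w m)\<^sup>2 \<le> 4 * (real L)\<^sup>2 * (w m)\<^sup>2"
    proof -
      have "real L * (w m)\<^sup>2 \<le> (real L)\<^sup>2 * (w m)\<^sup>2"
        using L1 by (intro mult_right_mono) (auto simp: power2_eq_square)
      moreover have "0 \<le> (real L)\<^sup>2 * (w m)\<^sup>2" by simp
      ultimately show ?thesis by linarith
    qed
    ultimately show "c m * (\<theta> m)\<^sup>2 - 2 * real L * w m * \<theta> m - (c m * (\<eta> m)\<^sup>2 - 2 * real L * w m * \<eta> m)
        \<le> 2 * real L * ((\<theta> m)\<^sup>2 + 2 * real L * (w m)\<^sup>2)"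
      by (simp add: power2_eq_square algebra_simps)
  qed
  have bounded: "vnorm d (\<Theta> t) \<le> sqrt (2 * Vfun l L f (\<Theta> 0) + 4 * (real L)\<^sup>2 * (vnorm (l L) (f (\<lambda>_. 0)))\<^sup>2)"
    if t: "t \<ge> 0" for t
  proof -
    have "0 \<le> 4 * real L * t * loss relu_act (\<Theta> t)" using t loss_nonneg by simp
    then have "lyapunov c w (\<Theta> t) \<le> lyapunov c w (\<Theta> 0)" using decrease[OF t] by linarith
    then show ?thesis
      unfolding V d_def y_def[symmetric] vnorm_def[of "dsum l L"]
      using V_lower[of "\<Theta> t"] by (intro real_sqrt_le_mono) linarith
  qed
  have decay: "loss_inf l L \<mu> f (\<Theta> t)
      \<le> 1 / (2 * t) * ((vnorm d (\<Theta> 0))\<^sup>2 + 2 * real L * (vnorm (l L) (f (\<lambda>_. 0)))\<^sup>2)" if t: "t > 0" for t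
  proof -
    let ?E = "(vnorm (dsum l L) (\<Theta> 0))\<^sup>2 + 2 * real L * (vnorm (l L) y)\<^sup>2"
    \<comment> \<open>Writing 4 L t as 2 L times 2 t exposes the factor 2 L of
      \<open>V_diff\<close>, which cancels and leaves the constant 1 / (2 t).\<close>
    have "2 * real L * (2 * t * loss relu_act (\<Theta> t)) \<le> 2 * real L * ?E"
      using decrease[of t] V_diff[of "\<Theta> 0" "\<Theta> t"] t by (simp add: mult_ac)
    then have "2 * t * loss relu_act (\<Theta> t) \<le> ?E" using L_pos' by simp
    then show ?thesis unfolding loss_inf d_def y_def[symmetric] using t by (simp add: field_simps)
  qed
  have "((\<lambda>t. loss_inf l L \<mu> f (\<Theta> t)) \<longlongrightarrow> 0) at_top"
  proof (rule tendsto_sandwich[OF always_eventually])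
    let ?E = "(vnorm d (\<Theta> 0))\<^sup>2 + 2 * real L * (vnorm (l L) (f (\<lambda>_. 0)))\<^sup>2"
    show "\<forall>t. 0 \<le> loss_inf l L \<mu> f (\<Theta> t)" by (simp add: loss_inf loss_nonneg)
    show "\<forall>\<^sub>F t in at_top. loss_inf l L \<mu> f (\<Theta> t) \<le> 1 / (2 * t) * ?E"
      using eventually_gt_at_top[of "0::real"] by eventually_elim (rule decay)
    have "((\<lambda>t::real. 1 / (2 * t)) \<longlongrightarrow> 0) at_top"
      by (intro tendsto_divide_0[OF tendsto_const] filterlim_at_top_imp_at_infinity
          filterlim_tendsto_pos_mult_at_top[OF tendsto_const _ filterlim_ident]) simp
    then show "((\<lambda>t. 1 / (2 * t) * ?E) \<longlongrightarrow> 0) at_top" by (rule tendsto_mult_left_zero)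
  qed simp
  then have "((\<lambda>t. ereal (loss_inf l L \<mu> f (\<Theta> t))) \<longlongrightarrow> ereal 0) at_top" by (rule tendsto_ereal)
  then have "Limsup at_top (\<lambda>t. ereal (loss_inf l L \<mu> f (\<Theta> t))) = 0"
    by (simp add: lim_imp_Limsup zero_ereal_def)
  with bounded decay show ?thesis by blast
qed

end
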